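(* Let $d\ge2$. The Selmer algorithm $S:\Sigma_d\to\Sigma_d$ is ergodic with respect to Lebesgue measure on $\Sigma_d$; that is, every measurable $V\subset\Sigma_d$ with $S(V)\subset V$ and $S^{-1}(V)\subset V$ has either zero Lebesgue measure or complement in $\Sigma_d$ of zero Lebesgue measure.
   Context: $\Sigma_d=\{\bar x=(x[1],\dots,x[d])\in\mathbb{R}^d:\ 0\le x[1]\le x[2]\le\dots\le x[d]\}$. For $\bar x\in\Sigma_d$, $S(\bar x)$ is the vector obtained by arranging the $d$ numbers $x[1],\dots,x[d-1],x[d]-x[1]$ in ascending order. *)

theory Defs
  imports "HOL-Analysis.Analysis"
begin

text \<open>
  Points of \<open>\<real>\<^sup>d\<close> are vectors \<open>real ^ 'n\<close> with \<open>d = CARD('n)\<close>. The index type is a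
  finite linear order (class \<open>wellorder\<close>, as in the change-of-variables theory of
  HOL-Analysis), so that coordinates 1 and d are those at \<open>Min UNIV\<close> and \<open>Max UNIV\<close>.
\<close>

definition Sigma_cone :: "(real ^ 'n::{finite,wellorder}) set" where
  "Sigma_cone = {x. 0 \<le> x $ Min UNIV \<and> mono (\<lambda>i. x $ i)}"

text \<open>The number of indices below \<open>i\<close> is the zero-based position of \<open>i\<close>.\<close>

definition sort_vec :: "real ^ 'n::{finite,wellorder} \<Rightarrow> real ^ 'n::_" where
  "sort_vec y = (\<chi> i. sort (map (\<lambda>j. y $ j) (sorted_list_of_set UNIV)) ! card {j. j < i})"

definition selmer :: "real ^ 'n::{finite,wellorder} \<Rightarrow> real ^ 'n::_" where
  "selmer x = sort_vec (\<chi> i. if i = Max UNIV then x $ Max UNIV - x $ Min UNIV else x $ i)"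

text \<open>
  The preimage is taken under \<open>T\<close> as a self-map of \<open>A\<close>, hence the intersection with \<open>A\<close>.
  No invariance of the measure is assumed.
\<close>

definition ergodic_on :: "'a measure \<Rightarrow> 'a set \<Rightarrow> ('a \<Rightarrow> 'a) \<Rightarrow> bool" where
  "ergodic_on M A T \<longleftrightarrow>
     (\<forall>V. V \<in> sets M \<and> V \<subseteq> A \<and> T ` V \<subseteq> V \<and> A \<inter> T -` V \<subseteq> V \<longrightarrow>
        V \<in> null_sets M \<or> A - V \<in> null_sets M)"

lemma card_less_lt_CARD: "card {j. j < (i :: 'n::{finite,wellorder})} < CARD('n)"
  by (rule psubset_card_mono) auto

lemma nth_sorted_list_of_set_card_less:
  "sorted_list_of_set UNIV ! card {j. j < i} = (i :: 'n::{finite,wellorder})"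
proof -
  let ?l = "sorted_list_of_set (UNIV :: 'n set)"
  have sd: "sorted_wrt (<) ?l" by simp
  have "i \<in> set ?l" by simp
  then obtain k where k: "k < length ?l" "?l ! k = i" by (metis in_set_conv_nth)
  have less: "?l ! a < ?l ! b \<longleftrightarrow> a < b" if "a < length ?l" "b < length ?l" for a b
    using sd that by (metis linorder_neqE_nat order_less_asym sorted_wrt_nth_less order_less_irrefl)
  have "{j. j < i} = (!) ?l ` {..<k}"
  proof (intro set_eqI iffI)
    fix j assume "j \<in> {j. j < i}"
    moreover have "j \<in> set ?l" by simp
    then obtain a where "a < length ?l" "?l ! a = j" by (metis in_set_conv_nth)
    ultimately show "j \<in> (!) ?l ` {..<k}" using less k by (auto intro!: image_eqI[of _ _ a])
  next
    fix j assume "j \<in> (!) ?l ` {..<k}"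
    then show "j \<in> {j. j < i}" using less k by fastforce
  qed
  moreover have "inj_on ((!) ?l) {..<k}"
    using k by (auto intro!: inj_onI simp: nth_eq_iff_index_eq)
  ultimately have "card {j. j < i} = k" by (simp add: card_image)
  then show ?thesis using k by simp
qed

lemma mono_sort_vec: "mono (\<lambda>i. sort_vec y $ i)"
proof (rule monoI)
  fix i j :: 'a assume "i \<le> j"
  then have "card {k. k < i} \<le> card {k. k < j}" by (intro card_mono) auto
  then show "sort_vec y $ i \<le> sort_vec y $ j"
    using card_less_lt_CARD[of j] by (simp add: sort_vec_def sorted_nth_mono)
qed

lemma mset_sort_vec:
  "image_mset (\<lambda>i. sort_vec y $ i) (mset_set UNIV) = image_mset (\<lambda>i. y $ i) (mset_set UNIV)"
proof -
  let ?l = "sorted_list_of_set (UNIV :: 'a set)"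
  let ?s = "sort (map (\<lambda>j. y $ j) ?l)"
  have pos: "card {j. j < ?l ! n} = n" if "n < length ?l" for n
    using that nth_sorted_list_of_set_card_less[of "?l ! n"] card_less_lt_CARD[of "?l ! n"]
    by (simp add: nth_eq_iff_index_eq)
  have "map (\<lambda>i. sort_vec y $ i) ?l = ?s"
    by (rule nth_equalityI) (auto simp: sort_vec_def pos)
  then have "mset (map (\<lambda>i. sort_vec y $ i) ?l) = mset (map (\<lambda>j. y $ j) ?l)"
    by (metis mset_sort)
  moreover have "mset ?l = mset_set (UNIV :: 'a set)"
    using mset_set_set[of ?l] by simp
  ultimately show ?thesis
    by simp
qed

lemma selmer_in_Sigma_cone:
  assumes "x \<in> Sigma_cone"
  shows "selmer x \<in> Sigma_cone"
proof -
  define y where "y = (\<chi> i. if i = Max UNIV then x $ Max UNIV - x $ Min UNIV else x $ i)"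
  have m: "x $ i \<le> x $ j" if "i \<le> j" for i j
    using assms that by (auto simp: Sigma_cone_def mono_def)
  have nonneg: "0 \<le> x $ i" for i
    using assms m[of "Min UNIV" i] by (auto simp: Sigma_cone_def)
  have "0 \<le> y $ i" for i
    using nonneg m[of "Min UNIV" "Max UNIV"] by (auto simp: y_def)
  moreover have "sort_vec y $ Min UNIV \<in># image_mset (\<lambda>i. sort_vec y $ i) (mset_set UNIV)"
    by simp
  then have "sort_vec y $ Min UNIV \<in> range (\<lambda>i. y $ i)"
    unfolding mset_sort_vec by simp
  ultimately have "0 \<le> sort_vec y $ Min UNIV" by auto
  then show ?thesis
    using mono_sort_vec by (auto simp: Sigma_cone_def selmer_def y_def)
qed

end

theory Submission
  imports Defs "HOL-Library.Sublist"
begin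

text \<open>
  The cone \<open>x[d] \<le> x[1] + x[2]\<close> absorbs almost every orbit. In the coordinates given by the gaps
  \<open>x[k+1] - x[k]\<close> and \<open>x[1] + x[2] - x[d]\<close> it becomes the orthant, on which \<open>S\<close> has exactly two
  linear inverse branches, both onto subcones. Invariant sets are preserved by the linear maps
  \<open>Phi w\<close> of finite words \<open>w\<close> of branches, so relative densities transfer between a cylinder and
  the whole orthant without distortion.

  Started at the constant weights 1, the column sums of \<open>Phi w\<close> agree up to a factor 2 whenever
  the last letter is \<open>True\<close>, and almost every point has infinitely many letters \<open>True\<close>. From such
  a moment on any word of length \<open>d\<^sup>2\<close> contracts the cylinder by a fixed factor, so almost every
  point lies in arbitrarily narrow balanced cylinders. On a narrow cylinder an invariant set
  \<open>V\<close> is, up to a small error, a union of level sets of the height; comparing two level functions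
  related by a shear shows that \<open>V\<close> agrees with \<open>\<mu> V\<close> almost everywhere for every \<open>\<mu> > 0\<close>. For such a
  homogeneous \<open>V\<close>, the proportion of \<open>V\<close> in balanced cylinders is bounded away from 0 and 1 unless
  \<open>V\<close> or its complement is null, which contradicts a Lusin approximation.
\<close>

section \<open>Lebesgue measure and linear maps\<close>

text \<open>\<open>S\<close> commutes with positive scalings and cylinders are cones, so long words
  pin down the direction of a point but never its height; a density argument alone would give
  ergodicity of directions only. The radial part is settled by pulling back: \<open>Phi w\<close> is
  linear and preserves \<open>V\<close>, so if inside \<open>cyl w\<close> membership in
  \<open>V\<close> nearly depends on the height only, then on the orthant it nearly depends on the
  functional \<open>height \<circ> Phi w\<close> only. As \<open>V\<close> is also invariant under
  the shear, the same holds for that functional composed with the shear, and a point can be moved so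
  that the first value stays while the second is multiplied by \<open>\<mu>\<close>. The maps used
  for this have entries bounded independently of \<open>w\<close> because the column sums of
  \<open>Phi w\<close> are comparable; this is why balance is demanded besides narrowness. Errors
  are measured by one Lusin set, fixed before the cylinders are, and summed over a disjoint family;
  the determinant of \<open>Phi w\<close> multiplies both sides of each local estimate and cancels.
  In the original coordinates the height is \<open>x[2]\<close>, since the gaps telescope.\<close>

lemma lebesgue_sets_linear_image:
  fixes f :: "real^'n::{finite,wellorder} \<Rightarrow> real^'n::_"
  assumes "linear f" "S \<in> sets lebesgue"
  shows "f ` S \<in> sets lebesgue"
proof -
  have "S = (\<Union>n::nat. S \<inter> cball 0 (real n))"
    by (auto simp: real_arch_simple)
  then have "f ` S = (\<Union>n::nat. f ` (S \<inter> cball 0 (real n)))"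
    by blast
  moreover have "f ` (S \<inter> cball 0 (real n)) \<in> sets lebesgue" for n :: nat
    using assms by (intro fmeasurableD measurable_linear_image)
      (auto simp: lmeasurable_cball intro!: bounded_set_imp_lmeasurable)
  ultimately show ?thesis
    by auto
qed

lemma negligible_linear_image:
  fixes f :: "'a::euclidean_space \<Rightarrow> 'a"
  assumes "linear f" "negligible S"
  shows "negligible (f ` S)"
  using assms by (intro negligible_differentiable_image_negligible linear_imp_differentiable_on) auto

text \<open>Leibniz formula with a crude count of permutations. It will be applied to maps that vary
  with the word while their entries stay at most 2, so a bound by entries and dimension gives a
  uniform constant.\<close>

lemma abs_det_le:
  fixes A :: "real^'n::finite^'n"
  assumes "\<And>i j. \<bar>A $ i $ j\<bar> \<le> B"
  shows "\<bar>det A\<bar> \<le> fact CARD('n) * B ^ CARD('n)"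
proof -
  let ?P = "{p::'n \<Rightarrow> 'n. p permutes UNIV}"
  have "\<bar>det A\<bar> \<le> (\<Sum>p\<in>?P. \<bar>of_int (sign p) * (\<Prod>i\<in>UNIV. A $ i $ p i)\<bar>)"
    unfolding det_def by (rule sum_abs)
  also have "\<dots> \<le> (\<Sum>p\<in>?P. B ^ CARD('n))"
  proof (rule sum_mono)
    fix p :: "'n \<Rightarrow> 'n"
    have "\<bar>of_int (sign p) * (\<Prod>i\<in>UNIV. A $ i $ p i)\<bar> = (\<Prod>i\<in>UNIV. \<bar>A $ i $ p i\<bar>)"
      by (simp add: abs_mult abs_prod sign_def)
    also have "\<dots> \<le> (\<Prod>i\<in>(UNIV::'n set). B)"
      by (rule prod_mono) (use assms in auto)
    finally show "\<bar>of_int (sign p) * (\<Prod>i\<in>UNIV. A $ i $ p i)\<bar> \<le> B ^ CARD('n)"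
      by simp
  qed
  also have "\<dots> = fact CARD('n) * B ^ CARD('n)"
    by (simp add: card_permutations[OF refl])
  finally show ?thesis .
qed

lemma measure_linear_image_le:
  fixes f :: "real^'n::{finite,wellorder} \<Rightarrow> real^'n::_"
  assumes "linear f" "S \<in> lmeasurable" "\<And>i k. \<bar>f (axis i 1) $ k\<bar> \<le> B"
  shows "measure lebesgue (f ` S) \<le> fact CARD('n) * B ^ CARD('n) * measure lebesgue S"
proof -
  have "\<bar>matrix f $ k $ i\<bar> \<le> B" for k i
    using assms(3)[of i k] by (simp add: matrix_def)
  from abs_det_le[OF this] show ?thesis
    using assms(1,2) by (simp add: measure_linear_image mult_right_mono)
qed

text \<open>Countable additivity, carried out with extended nonnegative values to avoid summability
  questions. It turns estimates on single cylinders into global ones.\<close>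

lemma measure_le_by_pieces:
  assumes "countable I" "disjoint_family_on X I" "\<And>i. i \<in> I \<Longrightarrow> X i \<in> sets M"
    and S: "S \<in> fmeasurable M" and F: "F \<in> fmeasurable M"
    and cover: "S - (\<Union>i\<in>I. X i) \<in> null_sets M"
    and "C \<ge> 0" and le: "\<And>i. i \<in> I \<Longrightarrow> measure M (S \<inter> X i) \<le> C * measure M (F \<inter> X i)"
  shows "measure M S \<le> C * measure M F"
proof -
  note sets = assms(3)
  have UX: "(\<Union>i\<in>I. X i) \<in> sets M"
    using assms(1) sets by auto
  have eq: "emeasure M (G \<inter> (\<Union>i\<in>I. X i)) = (\<integral>\<^sup>+i. emeasure M (G \<inter> X i) \<partial>count_space I)"
    if "G \<in> sets M" for G
  proof -
    have "G \<inter> (\<Union>i\<in>I. X i) = (\<Union>i\<in>I. G \<inter> X i)" by blast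
    then show ?thesis
      using that assms(1,2) sets
      by (simp only:) (rule emeasure_UN_countable, auto simp: disjoint_family_on_def)
  qed
  have fin: "emeasure M (G \<inter> X i) = ennreal (measure M (G \<inter> X i))"
    if "G \<in> fmeasurable M" "i \<in> I" for G i
    using fmeasurable_Int_fmeasurable[OF that(1) sets[OF that(2)]] emeasure_eq_measure2 by blast
  have "emeasure M S \<le> emeasure M (S \<inter> (\<Union>i\<in>I. X i)) + emeasure M (S - (\<Union>i\<in>I. X i))"
    by (rule order_trans[OF _ emeasure_subadditive]) (use S UX in \<open>auto intro!: emeasure_mono\<close>)
  also have "\<dots> = (\<integral>\<^sup>+i. emeasure M (S \<inter> X i) \<partial>count_space I)"
    using cover S by (simp add: null_setsD1 eq fmeasurableD)
  also have "\<dots> \<le> (\<integral>\<^sup>+i. ennreal C * emeasure M (F \<inter> X i) \<partial>count_space I)"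
    using le \<open>C \<ge> 0\<close> by (intro nn_integral_mono)
      (simp add: fin[OF S] fin[OF F] flip: ennreal_mult)
  also have "\<dots> = ennreal C * emeasure M (F \<inter> (\<Union>i\<in>I. X i))"
    using F by (simp add: nn_integral_cmult eq fmeasurableD)
  also have "\<dots> \<le> ennreal C * emeasure M F"
    using F by (intro mult_left_mono emeasure_mono) auto
  finally have "ennreal (measure M S) \<le> ennreal (C * measure M F)"
    using S F \<open>C \<ge> 0\<close> by (simp add: emeasure_eq_measure2 ennreal_mult)
  then show ?thesis
    using \<open>C \<ge> 0\<close> by (subst (asm) ennreal_le_iff) auto
qed

text \<open>\<open>X \<inter> V\<close> and \<open>X - V\<close> are approximated from inside by
  closed sets. These are bounded, hence compact, and disjoint, so a positive distance separates
  them; \<open>F\<close> is what they miss.\<close>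

lemma lusin_indicator:
  fixes X :: "'a::euclidean_space set"
  assumes "X \<in> sets lebesgue" "bounded X" "V \<in> sets lebesgue" "\<epsilon> > 0"
  obtains F \<delta> where "F \<in> lmeasurable" "F \<subseteq> X" "measure lebesgue F < \<epsilon>" "\<delta> > 0"
    "\<forall>x\<in>X - F. \<forall>y\<in>X - F. dist x y < \<delta> \<longrightarrow> (x \<in> V \<longleftrightarrow> y \<in> V)"
proof -
  obtain K where K: "closed K" "K \<subseteq> X \<inter> V" "X \<inter> V - K \<in> lmeasurable"
      "emeasure lebesgue (X \<inter> V - K) < ennreal (\<epsilon> / 2)"
    using sets_lebesgue_inner_closed[of "X \<inter> V" "\<epsilon> / 2"] assms by (metis half_gt_zero sets.Int)
  obtain L where L: "closed L" "L \<subseteq> X - V" "X - V - L \<in> lmeasurable"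
      "emeasure lebesgue (X - V - L) < ennreal (\<epsilon> / 2)"
    using sets_lebesgue_inner_closed[of "X - V" "\<epsilon> / 2"] assms by (metis half_gt_zero sets.Diff)
  have "bounded K" "bounded L"
    using K(2) L(2) by (auto intro!: bounded_subset[OF assms(2)])
  with K L have "compact K" "compact L" "K \<inter> L = {}"
    by (auto simp: compact_eq_bounded_closed)
  then obtain \<delta> where \<delta>: "\<delta> > 0" "\<forall>x\<in>K. \<forall>y\<in>L. \<delta> \<le> dist x y"
    using separate_compact_closed[of K L] L(1) by blast
  define F where "F = (X \<inter> V - K) \<union> (X - V - L)"
  show thesis
  proof
    show "F \<in> lmeasurable" "F \<subseteq> X"
      unfolding F_def using K L by auto
    have "measure lebesgue F \<le> measure lebesgue (X \<inter> V - K) + measure lebesgue (X - V - L)"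
      unfolding F_def by (rule measure_Un_le) (use K L in auto)
    also have "\<dots> < \<epsilon> / 2 + \<epsilon> / 2"
      using K(4) L(4) unfolding emeasure_eq_measure2[OF K(3)] emeasure_eq_measure2[OF L(3)]
      by (intro add_strict_mono) (simp_all add: ennreal_less_iff)
    finally show "measure lebesgue F < \<epsilon>" by simp
    have "x \<in> V \<longleftrightarrow> y \<in> V" if "x \<in> X - F" "y \<in> X - F" "dist x y < \<delta>" for x y
      using that \<delta> unfolding F_def by (metis DiffD1 DiffD2 DiffI IntI UnI1 UnI2 dist_commute not_le)
    then show "\<forall>x\<in>X - F. \<forall>y\<in>X - F. dist x y < \<delta> \<longrightarrow> (x \<in> V \<longleftrightarrow> y \<in> V)"
      by blast
  qed (fact \<delta>(1))
qed

section \<open>Cylinders of the absorbing system\<close>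

definition ix :: "nat \<Rightarrow> 'n::{finite,wellorder}" where
  "ix k = sorted_list_of_set UNIV ! k"

definition pos :: "'n::{finite,wellorder} \<Rightarrow> nat" where
  "pos i = card {j. j < i}"

lemma ix_pos [simp]: "ix (pos i) = i"
  unfolding ix_def pos_def by (rule nth_sorted_list_of_set_card_less)

lemma pos_less: "pos (i :: 'n::{finite,wellorder}) < CARD('n)"
  unfolding pos_def by (rule card_less_lt_CARD)

lemma pos_ix [simp]:
  assumes "k < CARD('n)"
  shows "pos (ix k :: 'n::{finite,wellorder}) = k"
proof -
  have "sorted_list_of_set (UNIV::'n set) ! pos (ix k :: 'n) = sorted_list_of_set (UNIV::'n set) ! k"
    using ix_pos[of "ix k :: 'n"] by (simp add: ix_def)
  then show ?thesis
    using assms pos_less[of "ix k :: 'n"] by (simp add: nth_eq_iff_index_eq)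
qed

lemma ix_eq_iff:
  "\<lbrakk>j < CARD('n); k < CARD('n)\<rbrakk> \<Longrightarrow> (ix j :: 'n::{finite,wellorder}) = ix k \<longleftrightarrow> j = k"
  by (metis pos_ix)

lemma pos_mono: "pos i \<le> pos j \<longleftrightarrow> i \<le> j"
proof
  show "pos i \<le> pos j" if "i \<le> j"
    using that unfolding pos_def by (intro card_mono) auto
  show "i \<le> j" if "pos i \<le> pos j"
  proof (rule ccontr)
    assume "\<not> i \<le> j"
    then have "j < i" by simp
    then have "j \<in> {k. k < i}" "{k. k < j} \<subseteq> {k. k < i}" by (auto elim: order.strict_trans)
    then have "{k. k < j} \<subset> {k. k < i}" by blast
    then have "pos j < pos i"
      unfolding pos_def by (rule psubset_card_mono[rotated]) (rule finite)
    then show False using that by simp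
  qed
qed

lemma bij_betw_ix: "bij_betw (ix :: nat \<Rightarrow> 'n::{finite,wellorder}) {..<CARD('n)} UNIV"
  by (rule bij_betwI[where g = pos]) (auto simp: pos_less)

lemma sum_ix: "(\<Sum>i\<in>UNIV. f (i :: 'n::{finite,wellorder})) = (\<Sum>k<CARD('n). f (ix k))"
  using sum.reindex_bij_betw[OF bij_betw_ix, of f] by simp

lemma vec_eq_ix: "x = y \<longleftrightarrow> (\<forall>k<CARD('n). x $ ix k = y $ (ix k :: 'n::{finite,wellorder}))"
  by (metis ix_pos pos_less vec_eq_iff)

definition orthant :: "(real ^ 'n) set" where
  "orthant = {z. \<forall>i. 0 < z $ i}"

definition height :: "real ^ 'n \<Rightarrow> real" where
  "height z = (\<Sum>i\<in>UNIV. z $ i)"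

text \<open>The two inverse branches of \<open>S\<close> in gap coordinates; \<open>True\<close> is the branch on which the new
  number \<open>x[d] - x[1]\<close> becomes the smallest one.\<close>

definition step :: "bool \<Rightarrow> real ^ 'n::{finite,wellorder} \<Rightarrow> real ^ 'n::_" where
  "step b z = (\<chi> i.
     if pos i = 0 then if b then z $ ix 1 else z $ ix 0 + z $ ix 1
     else if Suc (pos i) = CARD('n) then if b then z $ ix 0 + z $ ix 1 else z $ ix 1
     else z $ ix (Suc (pos i)))"

definition unstep :: "bool \<Rightarrow> real ^ 'n::{finite,wellorder} \<Rightarrow> real ^ 'n::_" where
  "unstep b x = (\<chi> i.
     if pos i = 0 then
       if b then x $ ix (CARD('n) - 1) - x $ ix 0 else x $ ix 0 - x $ ix (CARD('n) - 1)
     else if pos i = 1 then if b then x $ ix 0 else x $ ix (CARD('n) - 1)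
     else x $ ix (pos i - 1))"

text \<open>The first letter is applied last and names the outermost branch, so extending a word on
  the right shrinks its cylinder.\<close>

definition Phi :: "bool list \<Rightarrow> real ^ 'n::{finite,wellorder} \<Rightarrow> real ^ 'n::_" where
  "Phi w z = foldr step w z"

definition cyl :: "bool list \<Rightarrow> (real ^ 'n::{finite,wellorder}) set" where
  "cyl w = Phi w ` orthant"

text \<open>Column sums of the matrix of \<open>Phi w\<close>; equivalently the coefficients of the
  functional \<open>height \<circ> Phi w\<close>.\<close>

definition wt :: "bool list \<Rightarrow> 'n::{finite,wellorder} \<Rightarrow> real" where
  "wt w i = height (Phi w (axis i 1))"

lemma linear_height: "linear height"
  unfolding height_def by (intro linearI) (auto simp: sum.distrib sum_distrib_left)

lemma linear_step: "linear (step b)"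
  unfolding step_def by (intro linearI) (auto simp: vec_eq_iff algebra_simps)

lemma Phi_Nil [simp]: "Phi [] = id"
  and Phi_Cons: "Phi (b # w) = step b \<circ> Phi w"
  and Phi_append: "Phi (v @ w) = Phi v \<circ> Phi w"
  by (auto simp: Phi_def fun_eq_iff)

lemma linear_Phi: "linear (Phi w)"
proof (induction w)
  case (Cons b w)
  then show ?case unfolding Phi_Cons by (intro linear_compose linear_step)
qed (auto intro: linearI)

lemma linear_expand:
  fixes f :: "real ^ 'n \<Rightarrow> 'a::real_vector"
  assumes "linear f"
  shows "f z = (\<Sum>i\<in>UNIV. z $ i *\<^sub>R f (axis i 1))"
proof -
  have "f z = f (\<Sum>i\<in>UNIV. z $ i *s axis i 1)"
    by (simp add: basis_expansion)
  also have "\<dots> = (\<Sum>i\<in>UNIV. z $ i *\<^sub>R f (axis i 1))"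
    using assms by (simp add: linear_sum linear_scale scalar_mult_eq_scaleR)
  finally show ?thesis .
qed

lemma height_Phi: "height (Phi w z) = (\<Sum>i\<in>UNIV. z $ i * wt w i)"
  using linear_expand[OF linear_compose[OF linear_Phi linear_height], of w z]
  by (simp add: wt_def)

lemma orthant_scaleR: "\<lbrakk>x \<in> orthant; t > 0\<rbrakk> \<Longrightarrow> t *\<^sub>R x \<in> orthant"
  by (simp add: orthant_def)

lemma open_orthant: "open (orthant :: (real ^ 'n) set)"
proof -
  have "open (\<Inter>i\<in>UNIV. {z :: real ^ 'n. 0 < z $ i})"
    by (intro open_INT ballI open_Collect_less continuous_on_component continuous_on_const
        continuous_on_id) simp
  moreover have "(\<Inter>i\<in>UNIV. {z :: real ^ 'n. 0 < z $ i}) = orthant"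
    by (auto simp: orthant_def)
  ultimately show ?thesis by metis
qed

lemma height_pos: "z \<in> orthant \<Longrightarrow> 0 < height z"
  by (auto simp: height_def orthant_def intro!: sum_pos)

lemma norm_le_height: "(\<And>i. 0 \<le> z $ i) \<Longrightarrow> norm z \<le> height z"
  using norm_le_l1_cart[of z] by (simp add: height_def)

text \<open>The points whose coding never stops. That the words of different lengths extend each
  other follows from \<open>cyl_comparable\<close>.\<close>

definition limset :: "(real ^ 'n::{finite,wellorder}) set" where
  "limset = (\<Inter>n. \<Union>w\<in>{w. length w = n}. cyl w)"

context
  assumes two: "2 \<le> CARD('n::{finite,wellorder})"
begin

lemma unstep_step: "unstep b (step b z) = (z :: real ^ 'n::_)"
  using two by (auto simp: vec_eq_ix unstep_def step_def Suc_diff_Suc)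

lemma step_unstep: "step b (unstep b x) = (x :: real ^ 'n::_)"
proof -
  have "k = CARD('n) - 1" if "Suc k = CARD('n)" for k using that by simp
  then show ?thesis
    using two by (auto simp: vec_eq_ix unstep_def step_def)
qed

lemma inj_Phi: "inj (Phi w :: real ^ 'n::_ \<Rightarrow> _)"
proof (induction w)
  case (Cons b w)
  have "inj (step b :: real ^ 'n::_ \<Rightarrow> _)"
    by (metis injI unstep_step)
  with Cons show ?case unfolding Phi_Cons by (intro inj_compose)
qed simp

lemma step_orthant: "z \<in> orthant \<Longrightarrow> step b z \<in> (orthant :: (real ^ 'n::_) set)"
  by (auto simp: orthant_def step_def add_pos_pos)

lemma Phi_orthant: "z \<in> orthant \<Longrightarrow> Phi w z \<in> (orthant :: (real ^ 'n::_) set)"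
  by (induction w) (auto simp: Phi_Cons step_orthant)

text \<open>The first and last coordinates of \<open>step b z\<close> are \<open>z $ ix 1\<close>
  and \<open>z $ ix 0 + z $ ix 1\<close>, in an order decided by \<open>b\<close>; comparing them
  reads off the branch. In the orthant the two images are thus disjoint and miss only a
  hyperplane.\<close>

lemma step_image_iff:
  assumes "x \<in> (orthant :: (real ^ 'n::_) set)"
  shows "x \<in> step b ` orthant \<longleftrightarrow>
    (if b then x $ ix 0 < x $ ix (CARD('n) - 1) else x $ ix (CARD('n) - 1) < x $ ix 0)"
    (is "_ \<longleftrightarrow> ?R")
proof
  assume "x \<in> step b ` orthant"
  then obtain z where "z \<in> orthant" "x = step b z" by blast
  then show ?R
    using two by (auto simp: step_def orthant_def)
next
  assume ?R
  then have "unstep b x \<in> orthant"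
    using assms by (auto simp: orthant_def unstep_def split: if_splits)
  then show "x \<in> step b ` orthant"
    by (metis imageI step_unstep)
qed

lemma cyl_Nil [simp]: "cyl [] = (orthant :: (real ^ 'n::_) set)"
  by (simp add: cyl_def)

lemma cyl_append: "cyl (v @ w) = (Phi v ` cyl w :: (real ^ 'n::_) set)"
  by (simp add: cyl_def Phi_append image_comp)

lemma cyl_subset: "cyl (v @ w) \<subseteq> (cyl v :: (real ^ 'n::_) set)"
  using Phi_orthant by (auto simp: cyl_def Phi_append)

lemma cyl_subset_orthant: "cyl w \<subseteq> (orthant :: (real ^ 'n::_) set)"
  using cyl_subset[of "[]" w] by simp

lemma open_cyl: "open (cyl w :: (real ^ 'n::_) set)"
proof -
  have "surj (Phi w :: real ^ 'n::_ \<Rightarrow> _)"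
    by (intro linear_inj_imp_surj linear_Phi inj_Phi)
  then show ?thesis
    unfolding cyl_def by (intro open_surjective_linear_image open_orthant linear_Phi)
qed

text \<open>A point determines its first letter by the comparison of its first and last coordinates,
  and \<open>unstep\<close> removes that letter.\<close>

lemma cyl_comparable:
  "\<lbrakk>z \<in> cyl v; z \<in> (cyl w :: (real ^ 'n::_) set); length v \<le> length w\<rbrakk> \<Longrightarrow> prefix v w"
proof (induction v arbitrary: w z)
  case (Cons a v)
  then obtain b w' where w: "w = b # w'" by (cases w) auto
  have za: "z \<in> step a ` cyl v" and zb: "z \<in> step b ` cyl w'"
    using Cons.prems w by (auto simp: cyl_def Phi_Cons)
  have "z \<in> orthant" using Cons.prems(1) cyl_subset_orthant by blast
  moreover have "z \<in> step a ` orthant" "z \<in> step b ` orthant"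
    using za zb cyl_subset_orthant by blast+
  ultimately have "a = b"
    using step_image_iff[of z a] step_image_iff[of z b] by (auto split: if_splits)
  with za zb obtain x x' where x: "x \<in> cyl v" "z = step a x" "x' \<in> cyl w'" "z = step a x'"
    by blast
  then have "unstep a z \<in> cyl v" "unstep a z \<in> cyl w'"
    using unstep_step[of a x] unstep_step[of a x'] by simp_all
  then show ?case
    using Cons.IH[of "unstep a z" w'] Cons.prems w \<open>a = b\<close> by simp
qed simp

text \<open>Pulled back to the orthant, a point in neither subcylinder has equal first and last
  coordinates, and linear images of hyperplanes are null.\<close>

lemma negligible_cyl_split:
  "negligible (cyl w - (cyl (w @ [True]) \<union> cyl (w @ [False])) :: (real ^ 'n::_) set)"
proof -
  let ?H = "{x :: real ^ 'n::_. (axis (ix 0) 1 - axis (ix (CARD('n) - 1)) 1) \<bullet> x = 0}"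
  have "axis (ix 0) (1::real) - axis (ix (CARD('n) - 1)) 1 \<noteq> (0 :: real ^ 'n::_)"
    using two by (auto simp: axis_eq_axis ix_eq_iff)
  then have "negligible ?H" by (intro negligible_hyperplane) auto
  then have "negligible (Phi w ` ?H)"
    by (rule negligible_linear_image[OF linear_Phi])
  moreover have "cyl w - (cyl (w @ [True]) \<union> cyl (w @ [False])) \<subseteq> Phi w ` ?H"
  proof
    fix x :: "real ^ 'n::_" assume x: "x \<in> cyl w - (cyl (w @ [True]) \<union> cyl (w @ [False]))"
    then obtain y where y: "y \<in> orthant" "x = Phi w y" by (auto simp: cyl_def)
    have "y \<notin> step b ` orthant" for b
      using x y by (cases b) (auto simp: cyl_append cyl_def[of "[_]"] Phi_Cons)
    from this[of True] this[of False] have "y $ ix 0 = y $ ix (CARD('n) - 1)"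
      using step_image_iff[OF y(1)] by auto
    then show "x \<in> Phi w ` ?H"
      using y by (auto simp: inner_diff_left inner_axis' intro!: imageI)
  qed
  ultimately show ?thesis by (rule negligible_subset)
qed

lemma negligible_orthant_limset: "negligible (orthant - limset :: (real ^ 'n::_) set)"
proof -
  have "negligible (orthant - (\<Union>w\<in>{w. length w = n}. cyl w) :: (real ^ 'n::_) set)" for n
  proof (induction n)
    case (Suc n)
    let ?N = "\<Union>w\<in>{w. length w = n}. cyl w - (cyl (w @ [True]) \<union> cyl (w @ [False])) :: (real ^ 'n::_) set"
    have "finite {w :: bool list. length w = n}"
      using finite_lists_length_eq[of "UNIV :: bool set" n] by simp
    then have "negligible ?N"
      by (intro negligible_Union) (auto intro: negligible_cyl_split)
    moreover have "orthant - (\<Union>w\<in>{w. length w = Suc n}. cyl w)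
      \<subseteq> (orthant - (\<Union>w\<in>{w. length w = n}. cyl w)) \<union> ?N"
      by (auto; metis length_append_singleton)
    ultimately show ?case
      using Suc negligible_Un negligible_subset by blast
  qed simp
  then have "negligible (\<Union>n. orthant - (\<Union>w\<in>{w. length w = n}. cyl w) :: (real ^ 'n::_) set)"
    by (intro negligible_countable_Union) auto
  moreover have "orthant - limset = (\<Union>n. orthant - (\<Union>w\<in>{w. length w = n}. cyl w))"
    by (auto simp: limset_def)
  ultimately show ?thesis by metis
qed

lemma limset_extend:
  assumes "z \<in> (limset :: (real ^ 'n::_) set)" "z \<in> cyl w"
  obtains u where "length u = l" "z \<in> cyl (w @ u)"
proof -
  obtain v where v: "length v = length w + l" "z \<in> cyl v"
    using assms(1) by (auto simp: limset_def)
  then have "prefix w v"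
    using cyl_comparable[OF assms(2) v(2)] by simp
  then show thesis
    using that v by (auto simp: prefix_def)
qed

end

section \<open>Column weights and contraction\<close>

text \<open>\<open>A t\<close> and \<open>R t\<close> model the supports of the column just pushed
  into a queue of length \<open>m\<close> and of the register. The pushed column contains both the
  old register and the column leaving the queue; the register is kept or replaced by the latter.
  Tracing the register back, \<open>R (n + i)\<close> is either still \<open>R n\<close>, inside
  \<open>A n\<close>, or was loaded from some \<open>A (n + k - m)\<close>, which meets
  \<open>A (n - m)\<close>, again inside \<open>A n\<close>. So each increase of the admissible lag
  \<open>s\<close> costs one queue length \<open>m\<close>.\<close>

lemma shared_ancestor:
  fixes A R :: "nat \<Rightarrow> 'a set"
  assumes ne: "\<And>t. A t \<noteq> {}" "\<And>t. R t \<noteq> {}"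
    and push: "\<And>t. t \<ge> m \<Longrightarrow> R t \<subseteq> A (Suc t)" "\<And>t. t \<ge> m \<Longrightarrow> A (Suc t - m) \<subseteq> A (Suc t)"
    and reg: "\<And>t. t \<ge> m \<Longrightarrow> R (Suc t) = R t \<or> R (Suc t) = A (Suc t - m)"
  shows "\<lbrakk>n > (s + 1) * m; i \<le> s\<rbrakk> \<Longrightarrow> A n \<inter> A (n + i) \<noteq> {}"
    and "\<lbrakk>n > (s + 2) * m; i \<le> s\<rbrakk> \<Longrightarrow> A n \<inter> R (n + i) \<noteq> {}"
proof -
  have sub: "R t \<subseteq> A t" "A (t - m) \<subseteq> A t" if "t > m" for t
  proof -
    obtain t' where "t = Suc t'" "t' \<ge> m" using \<open>t > m\<close> by (cases t) auto
    then show "R t \<subseteq> A t" "A (t - m) \<subseteq> A t" using push[of t'] reg[of t'] by auto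
  qed
  have R_cases: "R (n + j) = R n \<or> (\<exists>k\<in>{1..j}. R (n + j) = A (n + k - m))" if "n \<ge> m" for n j
  proof (induction j)
    case (Suc j)
    have "R (Suc (n + j)) = R (n + j) \<or> R (Suc (n + j)) = A (Suc (n + j) - m)"
      using reg[of "n + j"] that by simp
    then show ?case
      using Suc by (auto simp: Bex_def intro: le_SucI)
  qed simp
  have AR: "A n \<inter> R (n + i) \<noteq> {}"
    if IH: "\<And>n i. \<lbrakk>n > (s + 1) * m; i \<le> s\<rbrakk> \<Longrightarrow> A n \<inter> A (n + i) \<noteq> {}"
      and n: "n > (s + 2) * m" and i: "i \<le> s" for s n i
  proof -
    have nm: "n > m" "n - m > (s + 1) * m" using n by (auto simp: algebra_simps)
    consider "R (n + i) = R n" | k where "k \<in> {1..i}" "R (n + i) = A (n + k - m)"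
      using R_cases[of n i] nm by auto
    then show ?thesis
    proof cases
      case 1
      then show ?thesis using sub(1)[OF nm(1)] ne(2)[of n] by blast
    next
      case 2
      have "A (n - m) \<inter> A (n - m + k) \<noteq> {}"
        by (rule IH) (use nm 2 i in auto)
      moreover have "n - m + k = n + k - m" using nm by simp
      ultimately show ?thesis using sub(2)[OF nm(1)] 2 by auto
    qed
  qed
  show AA: "A n \<inter> A (n + i) \<noteq> {}" if "n > (s + 1) * m" "i \<le> s" for n i
    using that
  proof (induction s arbitrary: n i)
    case 0
    then show ?case using ne by simp
  next
    case (Suc s)
    show ?case
    proof (cases i)
      case (Suc j)
      have "A n \<inter> R (n + j) \<noteq> {}"
        by (rule AR[of s]) (use Suc Suc.IH Suc.prems in auto)
      moreover have "R (n + j) \<subseteq> A (n + i)"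
        using push(1)[of "n + j"] Suc Suc.prems by simp
      ultimately show ?thesis by blast
    qed (use ne in simp)
  qed
  show "A n \<inter> R (n + i) \<noteq> {}" if "n > (s + 2) * m" "i \<le> s" for n i
    by (rule AR[OF AA that])
qed

text \<open>Product coupling: multiplied by \<open>s\<close>, the difference is the sum of
  \<open>x i - x j\<close> with weights \<open>\<alpha> i * \<beta> j\<close>, whose total is
  \<open>s * s\<close>.\<close>

lemma norm_mass_diff_le:
  fixes x :: "'i::finite \<Rightarrow> 'v::real_normed_vector"
  assumes \<alpha>: "\<And>i. 0 \<le> \<alpha> i" "sum \<alpha> UNIV = s" and \<beta>: "\<And>i. 0 \<le> \<beta> i" "sum \<beta> UNIV = s"
    and x: "\<And>i j. norm (x i - x j) \<le> \<delta>"
  shows "norm ((\<Sum>i\<in>UNIV. \<alpha> i *\<^sub>R x i) - (\<Sum>i\<in>UNIV. \<beta> i *\<^sub>R x i)) \<le> s * \<delta>"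
proof (cases "s = 0")
  case True
  then have "\<alpha> i = 0" "\<beta> i = 0" for i
    using \<alpha> \<beta> by (auto simp: sum_nonneg_eq_0_iff)
  then show ?thesis using True by simp
next
  case False
  then have s: "s > 0" using \<alpha> sum_nonneg[of UNIV \<alpha>] by auto
  have "s *\<^sub>R ((\<Sum>i\<in>UNIV. \<alpha> i *\<^sub>R x i) - (\<Sum>j\<in>UNIV. \<beta> j *\<^sub>R x j))
    = (\<Sum>j\<in>UNIV. \<beta> j) *\<^sub>R (\<Sum>i\<in>UNIV. \<alpha> i *\<^sub>R x i) - (\<Sum>i\<in>UNIV. \<alpha> i) *\<^sub>R (\<Sum>j\<in>UNIV. \<beta> j *\<^sub>R x j)"
    by (simp add: \<alpha> \<beta> scaleR_diff_right)
  also have "\<dots> = (\<Sum>i\<in>UNIV. \<Sum>j\<in>UNIV. (\<alpha> i * \<beta> j) *\<^sub>R (x i - x j))"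
    unfolding scaleR_sum_left scaleR_sum_right
    by (subst sum.swap) (simp add: sum_subtractf scaleR_diff_right mult.commute)
  finally have eq: "s *\<^sub>R ((\<Sum>i\<in>UNIV. \<alpha> i *\<^sub>R x i) - (\<Sum>j\<in>UNIV. \<beta> j *\<^sub>R x j))
    = (\<Sum>i\<in>UNIV. \<Sum>j\<in>UNIV. (\<alpha> i * \<beta> j) *\<^sub>R (x i - x j))" .
  have "s * norm ((\<Sum>i\<in>UNIV. \<alpha> i *\<^sub>R x i) - (\<Sum>j\<in>UNIV. \<beta> j *\<^sub>R x j))
    = norm (\<Sum>i\<in>UNIV. \<Sum>j\<in>UNIV. (\<alpha> i * \<beta> j) *\<^sub>R (x i - x j))"
    using s arg_cong[OF eq, of norm] by simp
  also have "\<dots> \<le> (\<Sum>i\<in>UNIV. \<Sum>j\<in>UNIV. (\<alpha> i * \<beta> j) * \<delta>)"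
    using \<alpha> \<beta> x by (intro sum_norm_le order_trans[OF norm_sum] sum_mono) (auto intro!: mult_left_mono)
  also have "\<dots> = s * (s * \<delta>)"
    using \<alpha>(2) \<beta>(2) by (simp add: sum_product[symmetric] flip: sum_distrib_right sum_distrib_left)
  finally show ?thesis using s by simp
qed

text \<open>The columns divided by their sums have height 1; they are the vertices of the simplex
  that this level cuts from the closure of the cone \<open>cyl w\<close>. The type argument is there
  because a word does not determine the dimension.\<close>

definition narrow :: "bool list \<Rightarrow> real \<Rightarrow> 'n::{finite,wellorder} itself \<Rightarrow> bool" where
  "narrow w \<delta> TYPE('n) \<longleftrightarrow> (\<forall>i j :: 'n.
     norm (Phi w (axis i 1) /\<^sub>R wt w i - Phi w (axis j 1) /\<^sub>R wt w j) \<le> \<delta>)"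

context
  assumes two: "2 \<le> CARD('n::{finite,wellorder})"
begin

lemma step_axis_0:
  "step b (axis (ix 0) 1) = (axis (if b then ix (CARD('n) - 1) else ix 0) 1 :: real ^ 'n::_)"
  and step_axis_1: "step b (axis (ix 1) 1) = (axis (ix 0) 1 + axis (ix (CARD('n) - 1)) 1 :: real ^ 'n::_)"
  and step_axis: "\<lbrakk>2 \<le> k; k < CARD('n)\<rbrakk> \<Longrightarrow> step b (axis (ix k) 1) = (axis (ix (k - 1)) 1 :: real ^ 'n::_)"
  using two by (auto simp: vec_eq_ix step_def axis_def ix_eq_iff)

lemma wt_Nil: "wt [] (i :: 'n) = 1"
  by (simp add: wt_def height_def axis_def)

lemma wt_snoc_0: "wt (w @ [b]) (ix 0 :: 'n) = (if b then wt w (ix (CARD('n) - 1) :: 'n) else wt w (ix 0 :: 'n))"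
  and wt_snoc_1: "wt (w @ [b]) (ix 1 :: 'n) = wt w (ix 0 :: 'n) + wt w (ix (CARD('n) - 1) :: 'n)"
  and wt_snoc: "\<lbrakk>2 \<le> k; k < CARD('n)\<rbrakk> \<Longrightarrow> wt (w @ [b]) (ix k :: 'n) = wt w (ix (k - 1) :: 'n)"
  using step_axis_0[of b] step_axis_1[of b] step_axis[of k b]
  by (simp_all add: wt_def Phi_append Phi_Cons linear_add[OF linear_Phi] linear_add[OF linear_height])

text \<open>Read in the order of positions 0, d-1, d-2, ..., 1, the weights form a vector of the
  absorbing cone with positive first entry. Appending a letter acts on this vector by an inverse
  branch of \<open>S\<close> itself: the new largest entry is the sum of the two smallest, the new
  smallest is one of those two. This duality makes the property persist.\<close>

definition wt_sorted :: "bool list \<Rightarrow> bool" where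
  "wt_sorted w \<longleftrightarrow> 0 < wt w (ix 0 :: 'n) \<and> wt w (ix 0 :: 'n) \<le> wt w (ix (CARD('n) - 1) :: 'n)
     \<and> (\<forall>k\<ge>1. Suc k < CARD('n) \<longrightarrow> wt w (ix (Suc k) :: 'n) \<le> wt w (ix k :: 'n))
     \<and> wt w (ix 1 :: 'n) \<le> wt w (ix 0 :: 'n) + wt w (ix (CARD('n) - 1) :: 'n)"

lemma wt_sorted: "wt_sorted w"
proof (induction w rule: rev_induct)
  case Nil
  then show ?case by (simp add: wt_sorted_def wt_Nil)
next
  case (snoc b w)
  let ?d = "CARD('n)"
  show ?case
  proof (cases "?d = 2")
    case True
    then show ?thesis
      using snoc wt_snoc_0[of w b] wt_snoc_1[of w b] by (auto simp: wt_sorted_def)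
  next
    case False
    then have d: "?d \<ge> 3" using two by simp
    have "wt (w @ [b]) (ix (?d - 1) :: 'n) = wt w (ix (?d - 2) :: 'n)"
      using wt_snoc[of "?d - 1" w b] d by (simp add: numeral_2_eq_2)
    moreover have "wt w (ix (?d - 1) :: 'n) \<le> wt w (ix (?d - 2) :: 'n)"
    proof -
      have "?d - 1 = Suc (?d - 2)" "1 \<le> ?d - 2" using d by auto
      then show ?thesis using snoc unfolding wt_sorted_def by (metis One_nat_def diff_less two zero_less_one order_less_le_trans pos2)
    qed
    moreover have "wt (w @ [b]) (ix (Suc k) :: 'n) \<le> wt (w @ [b]) (ix k :: 'n)"
      if "k \<ge> 1" "Suc k < ?d" for k
    proof (cases "k = 1")
      case True
      then show ?thesis
        using snoc wt_snoc[of 2 w b] d wt_snoc_1[of w b] by (auto simp: wt_sorted_def numeral_2_eq_2)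
    next
      case False
      then have "Suc (k - 1) = k" "2 \<le> k" "k - 1 \<ge> 1" using that by auto
      then show ?thesis
        using snoc wt_snoc[of k w b] wt_snoc[of "Suc k" w b] that
        unfolding wt_sorted_def by (metis Suc_lessD diff_Suc_1 le_SucI)
    qed
    ultimately show ?thesis
      using snoc wt_snoc_0[of w b] wt_snoc_1[of w b] by (auto simp: wt_sorted_def)
  qed
qed

lemma wt_bounds:
  assumes "1 \<le> k" "k < CARD('n)"
  shows "wt w (ix (CARD('n) - 1) :: 'n) \<le> wt w (ix k :: 'n)" "wt w (ix k :: 'n) \<le> wt w (ix 1 :: 'n)"
proof -
  have anti: "wt w (ix l :: 'n) \<le> wt w (ix k :: 'n)" if "k \<le> l" "1 \<le> k" "l < CARD('n)" for k l
    using that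
  proof (induction rule: dec_induct)
    case (step l)
    then show ?case using wt_sorted[of w] unfolding wt_sorted_def
      by (meson Suc_lessD le_trans order_trans)
  qed simp
  show "wt w (ix (CARD('n) - 1) :: 'n) \<le> wt w (ix k :: 'n)" "wt w (ix k :: 'n) \<le> wt w (ix 1 :: 'n)"
    using assms by (auto intro!: anti)
qed

lemma wt_ge: "wt w (ix 0 :: 'n) \<le> wt w (i :: 'n)"
proof (cases "pos i = 0")
  case True
  then show ?thesis by (metis ix_pos order_refl)
next
  case False
  then show ?thesis
    using wt_bounds(1)[of "pos i" w] wt_sorted[of w] pos_less[of i] by (simp add: wt_sorted_def)
qed

lemma wt_pos: "0 < wt w (i :: 'n)"
  using wt_ge[of w i] wt_sorted[of w] by (simp add: wt_sorted_def)

text \<open>The letter \<open>True\<close> puts the second smallest weight at position 0, while the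
  new largest weight is the sum of the two smallest old ones, hence at most twice that.\<close>

lemma wt_balanced: "wt (w @ [True]) (i :: 'n) \<le> 2 * wt (w @ [True]) (ix 0 :: 'n)"
proof -
  have "wt (w @ [True]) (ix 0 :: 'n) = wt w (ix (CARD('n) - 1) :: 'n)"
    using wt_snoc_0[of w True] by simp
  moreover have "wt (w @ [True]) (ix 1 :: 'n) \<le> 2 * wt w (ix (CARD('n) - 1) :: 'n)"
    using wt_snoc_1[of w True] wt_sorted[of w] by (simp add: wt_sorted_def)
  moreover have "wt (w @ [True]) i \<le> wt (w @ [True]) (ix 1 :: 'n) \<or> i = ix 0"
    using wt_bounds(2)[of "pos i"] pos_less[of i] by (cases "pos i = 0") (auto, metis ix_pos)
  ultimately show ?thesis using wt_pos[of "w @ [True]" "ix 0"] by fastforce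
qed

lemma wt_append_le:
  assumes "\<And>i. wt w (i :: 'n) \<le> B"
  shows "wt (w @ u) (i :: 'n) \<le> 2 ^ length u * B"
proof (induction u arbitrary: i rule: rev_induct)
  case (snoc b u)
  have B: "0 < 2 ^ length u * B"
    using wt_pos[of "w @ u" "ix 0"] snoc[of "ix 0"] by linarith
  have "wt ((w @ u) @ [b]) (ix k :: 'n) \<le> 2 * (2 ^ length u * B)" if k: "k < CARD('n)" for k
  proof -
    consider "k = 0" | "k = 1" | "2 \<le> k" by linarith
    then show ?thesis
    proof cases
      case 1
      then show ?thesis using wt_snoc_0[of "w @ u" b] snoc[of "ix 0"] snoc[of "ix (CARD('n) - 1)"] B
        by (auto simp del: append_assoc)
    next
      case 2
      then show ?thesis using wt_snoc_1[of "w @ u" b] snoc[of "ix 0"] snoc[of "ix (CARD('n) - 1)"] B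
        by (auto simp del: append_assoc)
    next
      case 3
      then show ?thesis using wt_snoc[OF 3 k, of "w @ u" b] snoc[of "ix (k - 1)"] B
        by (auto simp del: append_assoc)
    qed
  qed
  from this[of "pos i"] pos_less[of i] show ?case by (simp add: mult.assoc)
qed (use assms in simp)

lemma Phi_nonneg: "(\<And>k. 0 \<le> y $ k) \<Longrightarrow> 0 \<le> (Phi w y :: real ^ 'n::_) $ i"
proof (induction w arbitrary: i)
  case (Cons b w)
  then have "\<And>i. 0 \<le> Phi w y $ i" by blast
  then show ?case by (auto simp: Phi_Cons step_def)
qed simp

text \<open>The columns behave like a register (position 0) and a queue entered at position 1: the column
  at position \<open>k \<ge> 1\<close> at time \<open>t\<close> was pushed at time \<open>t - (k - 1)\<close>.\<close>

lemma columns_share: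
  fixes i j :: 'n
  assumes "length u = (CARD('n))\<^sup>2"
  shows "\<exists>k. 1 \<le> Phi u (axis i 1) $ k \<and> 1 \<le> Phi u (axis j 1) $ k"
proof -
  let ?d = "CARD('n)"
  define m where "m = ?d - 1"
  define v where "v t = map (\<lambda>l. l < length u \<and> u ! l) [0..<t]" for t
  define X where "X t k = {l :: 'n. 1 \<le> Phi (v t) (axis (ix k) 1) $ l}" for t k
  have vS: "v (Suc t) = v t @ [t < length u \<and> u ! t]" for t by (simp add: v_def)
  have vu: "v (length u) = u"
    unfolding v_def by (rule nth_equalityI) auto
  have pd: "pos i < ?d" for i :: 'n by (rule pos_less)
  have X0: "X (Suc t) 0 = X t 0 \<or> X (Suc t) 0 = X t m" for t
    by (simp add: X_def vS Phi_append Phi_Cons step_axis_0 m_def)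
  have Xk: "X (Suc t) k = X t (k - 1)" if "2 \<le> k" "k < ?d" for t k
    using that by (simp add: X_def vS Phi_append Phi_Cons step_axis)
  have X1: "X t 0 \<subseteq> X (Suc t) 1" "X t m \<subseteq> X (Suc t) 1" for t
  proof -
    have "Phi (v (Suc t)) (axis (ix 1) 1) = Phi (v t) (axis (ix 0) 1) + Phi (v t) (axis (ix m :: 'n) 1)"
      using step_axis_1 by (simp add: vS Phi_append Phi_Cons m_def linear_add[OF linear_Phi])
    moreover have "0 \<le> Phi (v t) (axis k 1 :: real ^ 'n::_) $ l" for k l
      by (rule Phi_nonneg) (simp add: axis_def)
    ultimately show "X t 0 \<subseteq> X (Suc t) 1" "X t m \<subseteq> X (Suc t) 1"
      unfolding X_def by (auto intro: add_increasing add_increasing2)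
  qed
  have ne: "X t k \<noteq> {}" if "k < ?d" for t k
    using that
  proof (induction t arbitrary: k)
    case 0
    then show ?case by (auto simp: X_def v_def axis_def)
  next
    case (Suc t)
    have m: "m < ?d" using two by (simp add: m_def)
    consider "k = 0" | "k = 1" | "2 \<le> k" by linarith
    then show ?case
    proof cases
      case 1
      then show ?thesis using X0[of t] Suc.IH[of 0] Suc.IH[OF m] by auto
    next
      case 2
      then show ?thesis using X1[of t] Suc.IH[OF m] by auto
    next
      case 3
      then show ?thesis using Xk[of k t] Suc by auto
    qed
  qed
  have XA: "X t k = X (t - (k - 1)) 1" if "1 \<le> k" "k < ?d" "k \<le> t" for t k
    using that
  proof (induction k arbitrary: t)
    case (Suc k)
    show ?case
    proof (cases "k = 0")
      case False
      obtain t' where t': "t = Suc t'" using Suc.prems by (cases t) auto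
      have "X t (Suc k) = X t' k" using Xk[of "Suc k" t'] t' False Suc.prems by simp
      also have "\<dots> = X (t' - (k - 1)) 1" using Suc.IH[of t'] t' False Suc.prems by simp
      also have "t' - (k - 1) = t - (Suc k - 1)" using t' False by simp
      finally show ?thesis .
    qed simp
  qed simp
  have d: "?d = Suc m" "m \<ge> 1" using two by (auto simp: m_def)
  have old: "X t m = X (Suc t - m) 1" if "t \<ge> m" for t
    using XA[of m t] d that by (simp add: Suc_diff_le)
  note share = shared_ancestor[where A = "\<lambda>t. X t 1" and R = "\<lambda>t. X t 0" and m = m and s = "m - 1"]
  have reg: "X (Suc t) 0 = X t 0 \<or> X (Suc t) 0 = X (Suc t - m) 1"
    and push: "X (Suc t - m) 1 \<subseteq> X (Suc t) 1" if "t \<ge> m" for t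
    using X0[of t] X1[of t] old[OF that] by auto
  have ne01: "X t 0 \<noteq> {}" "X t 1 \<noteq> {}" for t
    using ne d by auto
  have AA: "X n 1 \<inter> X (n + l) 1 \<noteq> {}" if "n > m * m" "l < m" for n l
    by (rule share(1)) (use that d ne01 X1 reg push in auto)
  have AR: "X n 1 \<inter> X (n + l) 0 \<noteq> {}" if "n > (m + 1) * m" "l < m" for n l
    by (rule share(2)) (use that d ne01 X1 reg push in auto)
  let ?L = "length u"
  \<comment> \<open>Here \<open>m * m + 2 * m + 1\<close> is the square of \<open>CARD('n)\<close>.
    The column at position \<open>m\<close> was pushed \<open>m - 1\<close> steps before the end,
    and the push time must still exceed \<open>(m + 1) * m\<close>; this is what the length of
    \<open>u\<close> provides.\<close>
  have L: "?L = m * m + 2 * m + 1" using assms d by (simp add: power2_eq_square)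
  have *: "X ?L p \<inter> X ?L q \<noteq> {}" if "p \<le> q" "q < ?d" for p q
  proof -
    consider "q = 0" | "p = 0" "q \<ge> 1" | "p \<ge> 1" "q \<ge> 1" using that by linarith
    then show ?thesis
    proof cases
      case 1
      then show ?thesis using that ne[of 0 ?L] by simp
    next
      case 2
      have "X (?L - (q - 1)) 1 \<inter> X (?L - (q - 1) + (q - 1)) 0 \<noteq> {}"
        by (rule AR) (use that d L 2 in \<open>auto simp: algebra_simps\<close>)
      then show ?thesis using 2 that L d XA[of q ?L] by auto
    next
      case 3
      have "X (?L - (q - 1)) 1 \<inter> X (?L - (q - 1) + (q - p)) 1 \<noteq> {}"
        by (rule AA) (use that d L 3 in \<open>auto simp: algebra_simps\<close>)
      moreover have "?L - (q - 1) + (q - p) = ?L - (p - 1)" using 3 that L d by simp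
      ultimately show ?thesis using 3 that L d XA[of q ?L] XA[of p ?L] by auto
    qed
  qed
  have "X ?L (pos i) \<inter> X ?L (pos j) \<noteq> {}"
    using *[of "pos i" "pos j"] *[of "pos j" "pos i"] pd[of i] pd[of j] by (metis inf_commute linear)
  then show ?thesis by (auto simp: X_def vu)
qed

end

section \<open>Cross-sections of cylinders, and partitions into narrow balanced cylinders\<close>

definition shear :: "real ^ 'n::{finite,wellorder} \<Rightarrow> real ^ 'n::_" where
  "shear z = z + (height z - z $ ix 0) *\<^sub>R axis (ix 0) 1"

context
  assumes two: "2 \<le> CARD('n::{finite,wellorder})"
begin

lemma Phi_eq_mass:
  "Phi w y = (\<Sum>k\<in>UNIV. (y $ k * wt w k) *\<^sub>R (Phi w (axis k 1) /\<^sub>R wt w k) :: real ^ 'n::_)"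
proof -
  have "wt w k \<noteq> 0" for k :: 'n using wt_pos[OF two, of w k] by simp
  then have "(y $ k * wt w k) *\<^sub>R (Phi w (axis k 1) /\<^sub>R wt w k) = y $ k *\<^sub>R Phi w (axis k 1)" for k
    by simp
  then show ?thesis by (simp only: linear_expand[OF linear_Phi, of w y])
qed

text \<open>Both points are combinations of the normalised columns, with total masses equal to their
  heights. After rescaling \<open>z'\<close> to the height of \<open>z\<close> the equal-mass
  estimate applies; the rescaling costs the difference of heights because the norm is at most the
  height.\<close>

lemma narrow_dist:
  assumes "narrow w \<delta> TYPE('n)" "z \<in> cyl w" "z' \<in> (cyl w :: (real ^ 'n::_) set)"
  shows "norm (z - z') \<le> height z * \<delta> + \<bar>height z - height z'\<bar>"
proof -
  obtain y y' where y: "y \<in> orthant" "z = Phi w y" "y' \<in> orthant" "z' = Phi w y'"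
    using assms by (auto simp: cyl_def)
  let ?x = "\<lambda>k. Phi w (axis k 1) /\<^sub>R wt w k :: real ^ 'n::_"
  define r where "r = height z / height z'"
  have o: "z \<in> orthant" "z' \<in> orthant" using assms cyl_subset_orthant[OF two] by auto
  note h = height_pos[OF o(1)] height_pos[OF o(2)]
  then have r: "r > 0" "r * height z' = height z" by (auto simp: r_def)
  have "z = (\<Sum>k\<in>UNIV. (y $ k * wt w k) *\<^sub>R ?x k)"
    and "r *\<^sub>R z' = (\<Sum>k\<in>UNIV. (r * (y' $ k * wt w k)) *\<^sub>R ?x k)"
    unfolding y using Phi_eq_mass[of w y] Phi_eq_mass[of w "r *\<^sub>R y'"]
    by (simp_all only: linear_scale[OF linear_Phi] vector_scaleR_component real_scaleR_def mult.assoc)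
  moreover have "norm ((\<Sum>k\<in>UNIV. (y $ k * wt w k) *\<^sub>R ?x k) - (\<Sum>k\<in>UNIV. (r * (y' $ k * wt w k)) *\<^sub>R ?x k))
      \<le> height z * \<delta>"
  proof (rule norm_mass_diff_le)
    show "0 \<le> y $ i * wt w i" "0 \<le> r * (y' $ i * wt w i)" for i
      using y r wt_pos[OF two, of w i] by (auto simp: orthant_def less_imp_le)
    show "(\<Sum>i\<in>UNIV. y $ i * wt w i) = height z" "(\<Sum>i\<in>UNIV. r * (y' $ i * wt w i)) = height z"
      using r y by (simp_all add: height_Phi flip: sum_distrib_left)
    show "norm (?x i - ?x j) \<le> \<delta>" for i j
      using assms(1) by (simp add: narrow_def)
  qed
  ultimately have 1: "norm (z - r *\<^sub>R z') \<le> height z * \<delta>" by metis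
  have "norm (r *\<^sub>R z' - z') = \<bar>r - 1\<bar> * norm z'"
    by (metis norm_scaleR scaleR_left_diff_distrib scaleR_one)
  also have "\<dots> \<le> \<bar>r - 1\<bar> * height z'"
    using norm_le_height[of z'] o by (intro mult_left_mono) (auto simp: orthant_def less_imp_le)
  also have "\<dots> = \<bar>height z - height z'\<bar>"
    using r(2) h abs_mult_pos[of "height z'" "r - 1"] by (simp add: left_diff_distrib)
  finally have "norm (r *\<^sub>R z' - z') \<le> \<bar>height z - height z'\<bar>" .
  with 1 show ?thesis
    using norm_triangle_ineq[of "z - r *\<^sub>R z'" "r *\<^sub>R z' - z'"] by simp
qed

lemma wt_append: "wt (w @ u) i = (\<Sum>k\<in>UNIV. Phi u (axis i 1) $ k * wt w (k :: 'n))"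
proof -
  have "wt (w @ u) i = height (Phi w (Phi u (axis i 1)))"
    by (simp only: wt_def Phi_append comp_apply)
  also have "\<dots> = (\<Sum>k\<in>UNIV. Phi u (axis i 1) $ k * wt w (k :: 'n))"
    by (rule height_Phi)
  finally show ?thesis .
qed

text \<open>Normalisation turns nonnegative combinations of columns into convex ones
  (\<open>column_weights\<close>), so the cross-section of a longer word lies in that of its
  prefix.\<close>

lemma column_append:
  "Phi (w @ u) (axis i 1) /\<^sub>R wt (w @ u) i
    = (\<Sum>k\<in>UNIV. (Phi u (axis i 1) $ k * wt w k / wt (w @ u) i) *\<^sub>R
        (Phi w (axis k 1) /\<^sub>R wt w k) :: real ^ 'n::_)"
proof -
  have "Phi (w @ u) (axis i 1) /\<^sub>R wt (w @ u) i
    = (\<Sum>k\<in>UNIV. (Phi u (axis i 1) $ k * wt w k) *\<^sub>R (Phi w (axis k 1) /\<^sub>R wt w k)) /\<^sub>R wt (w @ u) i"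
    using Phi_eq_mass[of w "Phi u (axis i 1)"] by (simp only: Phi_append comp_apply)
  then show ?thesis
    by (simp only: scaleR_sum_right scaleR_scaleR[of _ "_ * _"] divide_inverse mult.commute)
qed

lemma column_weights:
  "0 \<le> Phi u (axis i 1) $ k * wt w k / wt (w @ u) (i :: 'n)"
  "(\<Sum>k\<in>UNIV. Phi u (axis i 1) $ k * wt w k / wt (w @ u) (i :: 'n)) = 1"
proof -
  show "0 \<le> Phi u (axis i 1) $ k * wt w k / wt (w @ u) i"
    using wt_pos[OF two, of w k] wt_pos[OF two, of "w @ u" i] Phi_nonneg[OF two, of "axis i 1" u k]
    by (auto simp: axis_def)
  show "(\<Sum>k\<in>UNIV. Phi u (axis i 1) $ k * wt w k / wt (w @ u) i) = 1"
    using wt_pos[OF two, of "w @ u" i] by (simp add: wt_append flip: sum_divide_distrib)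
qed

lemma narrow_append:
  assumes "narrow w \<delta> TYPE('n)"
  shows "narrow (w @ u) \<delta> TYPE('n)"
  unfolding narrow_def column_append
proof (intro allI order_trans[OF norm_mass_diff_le[OF column_weights column_weights, of _ \<delta>]])
  show "norm (Phi w (axis k 1) /\<^sub>R wt w k - Phi w (axis l 1) /\<^sub>R wt w l) \<le> \<delta>" for k l :: 'n
    using assms by (simp add: narrow_def)
qed simp

lemma narrow_contract:
  assumes nar: "narrow w \<delta> TYPE('n)" and bal: "\<And>i :: 'n. wt w i \<le> 2 * wt w (ix 0 :: 'n)"
    and u: "length u = (CARD('n))\<^sup>2"
  shows "narrow (w @ u) ((1 - 1 / 2 ^ Suc ((CARD('n))\<^sup>2)) * \<delta>) TYPE('n)"
  unfolding narrow_def
proof (intro allI)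
  fix i j :: 'n
  \<comment> \<open>A shared row \<open>l\<close> contributes an entry at least 1 times a weight at
    least the smallest one. The total is at most twice the smallest weight, doubled once per letter
    of \<open>u\<close>. Their quotient is at least \<open>\<eta>\<close>.\<close>
  define \<eta> :: real where "\<eta> = 1 / 2 ^ Suc ((CARD('n))\<^sup>2)"
  let ?x = "\<lambda>k. Phi w (axis k 1) /\<^sub>R wt w k :: real ^ 'n::_"
  let ?\<alpha> = "\<lambda>i k. Phi u (axis i 1) $ k * wt w k / wt (w @ u) i"
  obtain l where l: "1 \<le> Phi u (axis i 1) $ l" "1 \<le> Phi u (axis j 1) $ l"
    using columns_share[OF two u] by blast
  have big: "\<eta> \<le> ?\<alpha> i l" if "1 \<le> Phi u (axis i 1) $ l" for i :: 'n
  proof -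
    have w: "0 < wt w (ix 0 :: 'n)" "0 < wt (w @ u) i" "wt w (ix 0 :: 'n) \<le> wt w l"
      using wt_pos[OF two] wt_ge[OF two] by auto
    have "wt (w @ u) i \<le> 2 ^ length u * (2 * wt w (ix 0 :: 'n))"
      by (rule wt_append_le[OF two bal])
    then have "\<eta> * wt (w @ u) i \<le> wt w (ix 0 :: 'n)"
      by (simp add: \<eta>_def u field_simps)
    also have "\<dots> \<le> Phi u (axis i 1) $ l * wt w l"
      using w that mult_mono[of 1 "Phi u (axis i 1) $ l" "wt w (ix 0 :: 'n)" "wt w l"] by simp
    finally show ?thesis using w by (simp add: field_simps)
  qed
  \<comment> \<open>Both convex combinations put mass at least \<open>\<eta>\<close> on vertex
    \<open>l\<close>; removing it leaves their difference unchanged and the masses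
    \<open>1 - \<eta>\<close>.\<close>
  define \<beta> where "\<beta> i k = ?\<alpha> i k - (if k = l then \<eta> else 0)" for i k
  have "norm ((\<Sum>k\<in>UNIV. \<beta> i k *\<^sub>R ?x k) - (\<Sum>k\<in>UNIV. \<beta> j k *\<^sub>R ?x k)) \<le> (1 - \<eta>) * \<delta>"
  proof (rule norm_mass_diff_le)
    show "0 \<le> \<beta> i k" "0 \<le> \<beta> j k" for k
      using big l column_weights(1) by (auto simp: \<beta>_def)
    show "sum (\<beta> i) UNIV = 1 - \<eta>" "sum (\<beta> j) UNIV = 1 - \<eta>"
      unfolding \<beta>_def by (simp_all add: sum_subtractf column_weights)
    show "norm (?x i - ?x j) \<le> \<delta>" for i j
      using nar by (simp add: narrow_def)
  qed
  moreover have "(\<Sum>k\<in>UNIV. \<beta> i k *\<^sub>R ?x k) = (\<Sum>k\<in>UNIV. ?\<alpha> i k *\<^sub>R ?x k) - \<eta> *\<^sub>R ?x l" for i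
  proof -
    have "(\<Sum>k\<in>UNIV. (if k = l then \<eta> else 0) *\<^sub>R ?x k) = \<eta> *\<^sub>R ?x l"
    proof -
      have "(if k = l then \<eta> else 0) *\<^sub>R ?x k = (if k = l then \<eta> *\<^sub>R ?x k else 0)" for k
        by simp
      then show ?thesis by (simp only: sum.delta finite UNIV_I if_True)
    qed
    then show ?thesis
      unfolding \<beta>_def scaleR_left_diff_distrib sum_subtractf by simp
  qed
  ultimately show "norm (Phi (w @ u) (axis i 1) /\<^sub>R wt (w @ u) i - Phi (w @ u) (axis j 1) /\<^sub>R wt (w @ u) j)
      \<le> (1 - 1 / 2 ^ Suc ((CARD('n))\<^sup>2)) * \<delta>"
    unfolding column_append \<eta>_def by simp
qed

text \<open>A \<open>False\<close> step adds coordinate 1 to coordinate 0 and rotates the others.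
  After one full turn they are back in place, and coordinate 0 has collected all of them.\<close>

lemma Phi_replicate_False: "Phi (replicate (CARD('n) - 1) False) z = shear (z :: real ^ 'n::_)"
proof -
  let ?m = "CARD('n) - 1"
  have *: "Phi (replicate k False) z $ ix p =
      (if p = 0 then \<Sum>l\<le>k. z $ ix l else if p + k \<le> ?m then z $ ix (p + k) else z $ ix (p + k - ?m))"
    if "k \<le> ?m" "p < CARD('n)" for k p
    using that
  proof (induction k arbitrary: p)
    case (Suc k)
    show ?case
    proof (cases "Suc p = CARD('n)")
      case True
      then have "p + Suc k - ?m = Suc k" "\<not> p + Suc k \<le> ?m" "p \<noteq> 0" using two by auto
      then show ?thesis
        using two Suc.IH[of 1] Suc.prems True by (simp add: Phi_Cons step_def)
    next
      case False
      then show ?thesis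
        using two Suc.IH[of 0] Suc.IH[of 1] Suc.IH[of "Suc p"] Suc.prems
        by (auto simp: Phi_Cons step_def Suc_le_eq)
    qed
  qed (use two in auto)
  have "height z = (\<Sum>l\<le>?m. z $ ix l)"
  proof -
    have "{..?m} = {..<CARD('n)}" using two by auto
    then show ?thesis by (simp add: height_def sum_ix)
  qed
  then show ?thesis
    using two by (auto simp: vec_eq_ix * shear_def axis_def ix_eq_iff)
qed

text \<open>Otherwise only \<open>False\<close> follows \<open>w\<close>. The point pulled back by
  \<open>Phi w\<close> is then in the image of every power of the shear, so its coordinate 0 exceeds
  any multiple of the sum of the other coordinates, a positive sum that the shear fixes.\<close>

lemma limset_True:
  assumes "z \<in> (limset :: (real ^ 'n::_) set)" "z \<in> cyl w"
  obtains v where "z \<in> cyl (w @ v @ [True])"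
proof (rule ccontr)
  assume contr: "\<not> thesis"
  obtain y where y: "y \<in> orthant" "z = Phi w y" using assms by (auto simp: cyl_def)
  have y_in: "y \<in> cyl u" if "z \<in> cyl (w @ u)" for u
    using that y inj_Phi[OF two, of w] by (auto simp: cyl_append[OF two] inj_image_mem_iff)
  have rep: "y \<in> cyl (replicate n False)" for n
  proof -
    obtain u where u: "length u = n" "z \<in> cyl (w @ u)"
      by (rule limset_extend[OF two assms])
    have "True \<notin> set u"
    proof
      assume "True \<in> set u"
      then obtain v v' where "u = v @ True # v'" by (meson split_list)
      then show False
        using contr that u cyl_subset[OF two, of "w @ v @ [True]" v'] by auto
    qed
    then have "u = replicate n False" using u by (intro replicate_eqI) auto
    then show ?thesis using y_in u by simp
  qed
  have sh: "height (shear x) - shear x $ ix 0 = height x - x $ ix 0" for x :: "real ^ 'n::_"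
    by (simp add: shear_def linear_add[OF linear_height] linear_scale[OF linear_height])
      (simp add: height_def axis_def)
  have small: "height y - y $ ix 0 = height x - x $ ix 0 \<and> y $ ix 0 = x $ ix 0 + real q * (height x - x $ ix 0)"
    if "y = Phi (replicate (q * (CARD('n) - 1)) False) x" for q x
    using that
  proof (induction q arbitrary: x)
    case (Suc q)
    have "replicate (Suc q * (CARD('n) - 1)) False
        = replicate (q * (CARD('n) - 1)) False @ replicate (CARD('n) - 1) False"
      by (simp flip: replicate_add add: add.commute)
    then have "y = Phi (replicate (q * (CARD('n) - 1)) False) (shear x)"
      using Suc.prems by (simp only: Phi_append comp_apply Phi_replicate_False)
    from Suc.IH[OF this] show ?case
      unfolding sh by (simp add: shear_def algebra_simps)
  qed simp
  have "height y - y $ ix 0 = (\<Sum>i\<in>UNIV - {ix 0}. y $ i)"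
    by (simp add: height_def sum_diff1)
  moreover have "\<dots> > 0"
  proof (rule sum_pos)
    have "ix 1 \<in> UNIV - {ix 0 :: 'n}" using two by (simp add: ix_eq_iff)
    then show "UNIV - {ix 0 :: 'n} \<noteq> {}" by blast
  qed (use y in \<open>auto simp: orthant_def\<close>)
  ultimately have pos: "height y - y $ ix 0 > 0" by simp
  obtain q where q: "y $ ix 0 < real q * (height y - y $ ix 0)"
    using reals_Archimedean3[OF pos] by blast
  obtain x where x: "x \<in> orthant" "y = Phi (replicate (q * (CARD('n) - 1)) False) x"
    using rep[of "q * (CARD('n) - 1)"] by (auto simp: cyl_def)
  have "y $ ix 0 = x $ ix 0 + real q * (height y - y $ ix 0)"
    using small[OF x(2)] by metis
  moreover have "x $ ix 0 > 0" using x(1) by (simp add: orthant_def)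
  ultimately show False using q by linarith
qed

text \<open>Two moves alternate: after a balanced word a block \<open>u\<close> contracts by the
  factor \<open>\<theta>\<close>, then the coding is followed to the next \<open>True\<close>, which
  restores balance without widening the cross-section. The initial 2 bounds the distance of two unit
  vectors.\<close>

lemma narrow_cover:
  assumes z: "z \<in> (limset :: (real ^ 'n::_) set)" and "\<delta> > 0"
  obtains w where "z \<in> cyl (w @ [True])" "narrow (w @ [True]) \<delta> TYPE('n)"
proof -
  define \<theta> :: real where "\<theta> = 1 - 1 / 2 ^ Suc ((CARD('n))\<^sup>2)"
  have \<theta>: "0 \<le> \<theta>" "\<theta> < 1" using one_le_power[of "2::real" "Suc ((CARD('n))\<^sup>2)"] by (auto simp: \<theta>_def divide_le_eq_1 simp del: power_Suc)
  have "\<exists>w. z \<in> cyl (w @ [True]) \<and> narrow (w @ [True]) (\<theta> ^ n * 2) TYPE('n)" for n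
  proof (induction n)
    case 0
    have "z \<in> cyl []" using z by (auto simp: limset_def)
    then obtain v where v: "z \<in> cyl (v @ [True])"
      using limset_True[OF z, of "[]"] by auto
    have "narrow [] 2 TYPE('n)"
      unfolding narrow_def
    proof (intro allI)
      fix i j :: 'n
      show "norm (Phi [] (axis i 1) /\<^sub>R wt [] i - Phi [] (axis j 1) /\<^sub>R wt [] j) \<le> 2"
        using norm_triangle_ineq4[of "axis i (1::real)" "axis j 1"] by (simp add: wt_Nil[OF two])
    qed
    then show ?case using v narrow_append[of "[]" 2 "v @ [True]"] by auto
  next
    case (Suc n)
    then obtain w where w: "z \<in> cyl (w @ [True])" "narrow (w @ [True]) (\<theta> ^ n * 2) TYPE('n)" by blast
    obtain u where u: "length u = (CARD('n))\<^sup>2" "z \<in> cyl ((w @ [True]) @ u)"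
      by (rule limset_extend[OF two z w(1)])
    obtain v where v: "z \<in> cyl (((w @ [True]) @ u) @ v @ [True])"
      by (rule limset_True[OF z u(2)])
    have "narrow ((w @ [True]) @ u) (\<theta> * (\<theta> ^ n * 2)) TYPE('n)"
      unfolding \<theta>_def by (rule narrow_contract[OF w(2)[unfolded \<theta>_def] wt_balanced[OF two] u(1)])
    from narrow_append[OF this, of "v @ [True]"] show ?case using v by (intro exI[of _ "((w @ [True]) @ u) @ v"]) (simp add: mult.assoc)
  qed
  moreover have "(\<lambda>n. \<theta> ^ n * 2) \<longlonglongrightarrow> 0 * 2"
    using \<theta> by (intro tendsto_mult LIMSEQ_power_zero tendsto_const) auto
  then have "\<exists>n. \<theta> ^ n * 2 < \<delta>"
    using order_tendstoD(2)[of "\<lambda>n. \<theta> ^ n * 2" 0 sequentially \<delta>] \<open>\<delta> > 0\<close>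
    by (auto simp: eventually_sequentially)
  ultimately obtain n w where "\<theta> ^ n * 2 < \<delta>" "z \<in> cyl (w @ [True])"
      "narrow (w @ [True]) (\<theta> ^ n * 2) TYPE('n)" by metis
  moreover from this have "narrow (w @ [True]) \<delta> TYPE('n)"
    unfolding narrow_def by (meson less_imp_le order_trans)
  ultimately show thesis using that by blast
qed

lemma narrow_partition:
  assumes "\<delta> > 0"
  obtains W where "disjoint_family_on (cyl :: _ \<Rightarrow> (real ^ 'n::_) set) W"
    "(limset :: (real ^ 'n::_) set) \<subseteq> (\<Union>w\<in>W. cyl w)"
    "\<And>w. w \<in> W \<Longrightarrow> narrow w \<delta> TYPE('n)"
    "\<And>w i. w \<in> W \<Longrightarrow> wt w (i :: 'n) \<le> 2 * wt w (ix 0 :: 'n)"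
proof
  define G where "G = {w @ [True] |w. narrow (w @ [True]) \<delta> TYPE('n)}"
  \<comment> \<open>Only prefix-minimal words are kept: incomparable words have disjoint cylinders,
    and for each point of \<open>limset\<close> the shortest word of \<open>G\<close> coding it
    survives.\<close>
  define W where "W = {w \<in> G. \<forall>v\<in>G. \<not> strict_prefix v w}"
  show "disjoint_family_on (cyl :: _ \<Rightarrow> (real ^ 'n::_) set) W"
    unfolding disjoint_family_on_def
  proof (intro ballI impI, rule ccontr)
    fix v w assume vw: "v \<in> W" "w \<in> W" "v \<noteq> w" "cyl v \<inter> cyl w \<noteq> ({} :: (real ^ 'n::_) set)"
    then obtain z where z: "z \<in> cyl v" "z \<in> (cyl w :: (real ^ 'n::_) set)" by blast
    then have "prefix v w \<or> prefix w v"
      using cyl_comparable[OF two z] cyl_comparable[OF two z(2) z(1)] by linarith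
    then show False
      using vw by (auto simp: W_def strict_prefix_def)
  qed
  show "limset \<subseteq> (\<Union>w\<in>W. cyl w :: (real ^ 'n::_) set)"
  proof
    fix z :: "real ^ 'n::_" assume z: "z \<in> limset"
    let ?P = "\<lambda>w. w \<in> G \<and> z \<in> cyl w"
    obtain w' where "?P w'" using narrow_cover[OF z assms] unfolding G_def by blast
    from ex_has_least_nat[of ?P, OF this, of length]
    obtain w where w: "?P w" "\<And>v. ?P v \<Longrightarrow> length w \<le> length v" by blast
    have "\<not> strict_prefix v w" if "v \<in> G" for v
    proof
      assume sp: "strict_prefix v w"
      then have "z \<in> cyl v" using w(1) cyl_subset[OF two, of v] by (auto simp: strict_prefix_def prefix_def)
      then show False using w(2)[of v] that prefix_length_less[OF sp] by simp
    qed
    then show "z \<in> (\<Union>w\<in>W. cyl w)" using w by (auto simp: W_def)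
  qed
  show "narrow w \<delta> TYPE('n)" if "w \<in> W" for w
    using that by (auto simp: W_def G_def)
  show "wt w i \<le> 2 * wt w (ix 0 :: 'n)" if "w \<in> W" for w and i :: 'n
    using that wt_balanced[OF two] by (auto simp: W_def G_def)
qed

end

section \<open>Invariant sets are homogeneous\<close>

lemma sublevel_lmeasurable:
  fixes l :: "real ^ 'n::finite \<Rightarrow> real"
  assumes "U \<in> sets lebesgue" "U \<subseteq> orthant" "linear l" "c > 0"
    and l: "\<And>z. z \<in> orthant \<Longrightarrow> c * height z \<le> l z"
  shows "{z \<in> U. l z \<le> s} \<in> lmeasurable"
proof (rule bounded_set_imp_lmeasurable)
  show "bounded {z \<in> U. l z \<le> s}"
  proof (rule boundedI)
    fix z assume z: "z \<in> {z \<in> U. l z \<le> s}"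
    then have "z \<in> orthant" using assms by auto
    then have "norm z \<le> height z" "c * height z \<le> s"
      using l[of z] z norm_le_height[of z] by (auto simp: orthant_def less_imp_le)
    then show "norm z \<le> s / c" using \<open>c > 0\<close> by (simp add: field_simps) (metis mult_left_mono less_imp_le order_trans)
  qed
  have "continuous_on UNIV l"
    using \<open>linear l\<close> by (simp add: linear_continuous_on linear_conv_bounded_linear)
  then have "closed {z. l z \<le> s}"
    by (intro closed_Collect_le continuous_intros) auto
  moreover have "{z \<in> U. l z \<le> s} = U \<inter> {z. l z \<le> s}" by blast
  ultimately show "{z \<in> U. l z \<le> s} \<in> sets lebesgue"
    using assms(1) by auto
qed

lemma measure_scaleR_image:
  "t > 0 \<Longrightarrow> measure lebesgue ((*\<^sub>R) t ` S) = t ^ CARD('n) * measure lebesgue (S :: (real ^ 'n) set)"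
  using measure_lebesgue_affine[of t 0 S] by simp

lemma orthant_lebesgue: "(orthant :: (real ^ 'n) set) \<in> sets lebesgue"
  using open_orthant[where 'n = 'n] by auto

lemma bounded_linear_entries_image:
  fixes f :: "real^'n::{finite,wellorder} \<Rightarrow> real^'n::_"
  assumes "linear f" "\<And>i k. \<bar>f (axis i 1) $ k\<bar> \<le> 2" "S \<in> lmeasurable" "measure lebesgue S \<le> m"
  shows "f ` S \<in> lmeasurable" "measure lebesgue (f ` S) \<le> fact CARD('n) * 2 ^ CARD('n) * m"
  using measurable_linear_image[OF assms(1,3)] measure_linear_image_le[OF assms(1,3,2)] assms(4)
  by (auto intro: order_trans mult_left_mono)

text \<open>The assumptions also hold for the orthant and for the complement of \<open>V\<close> in
  it, so every estimate is available for all three sets.\<close>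

locale step_invariant =
  fixes V :: "(real ^ 'n::{finite,wellorder}) set"
  assumes two: "2 \<le> CARD('n)"
    and V_sets: "V \<in> sets lebesgue"
    and V_orthant: "V \<subseteq> orthant"
    and V_step: "\<And>b z. z \<in> orthant \<Longrightarrow> step b z \<in> V \<longleftrightarrow> z \<in> V"
begin

lemma V_Phi: "z \<in> orthant \<Longrightarrow> Phi w z \<in> V \<longleftrightarrow> z \<in> V"
  by (induction w) (auto simp: Phi_Cons V_step Phi_orthant[OF two])

lemma V_shear: "z \<in> orthant \<Longrightarrow> shear z \<in> V \<longleftrightarrow> z \<in> V"
  using V_Phi Phi_replicate_False[OF two] by metis

definition moved :: "real \<Rightarrow> (real ^ 'n::_) set" where
  "moved \<mu> = {z \<in> orthant. (z \<in> V) \<noteq> (\<mu> *\<^sub>R z \<in> V)}"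

lemma moved_sets:
  assumes "\<mu> > 0"
  shows "moved \<mu> \<in> sets lebesgue"
proof -
  have "(*\<^sub>R) (1 / \<mu>) ` V \<in> sets lebesgue"
    by (intro lebesgue_sets_linear_image V_sets linear_scaleR)
  moreover have "\<mu> *\<^sub>R z \<in> V \<longleftrightarrow> z \<in> (*\<^sub>R) (1 / \<mu>) ` V" for z
    using assms by (auto simp: image_iff intro!: bexI[of _ "\<mu> *\<^sub>R z"])
  then have "moved \<mu> = (V - (*\<^sub>R) (1 / \<mu>) ` V) \<union> (orthant \<inter> (*\<^sub>R) (1 / \<mu>) ` V - V)"
    using V_orthant by (auto simp: moved_def)
  ultimately show ?thesis
    using V_sets orthant_lebesgue by auto
qed

lemma moved_Phi:
  assumes "z \<in> orthant" "\<mu> > 0"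
  shows "Phi w z \<in> moved \<mu> \<longleftrightarrow> z \<in> moved \<mu>"
proof -
  have "\<mu> *\<^sub>R Phi w z = Phi w (\<mu> *\<^sub>R z)" by (simp add: linear_scale[OF linear_Phi])
  then show ?thesis
    using assms V_Phi[of z w] V_Phi[of "\<mu> *\<^sub>R z" w] orthant_scaleR[of z \<mu>] Phi_orthant[OF two]
    by (simp add: moved_def)
qed

text \<open>On a balanced cylinder the level set of \<open>z\<close> is moved by a linear map preserving
  \<open>l = height \<circ> Phi w\<close>, then by the shear, which changes \<open>l\<close> in a way depending on the direction;
  composing the two realises the scaling by \<open>\<mu>\<close> as far as the values of \<open>l\<close> are concerned.\<close>

lemma moved_piece:
  assumes \<mu>: "1 < \<mu>" "\<mu> \<le> 33 / 32" and t: "t > 0"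
    and bal: "\<And>i :: 'n. wt w i \<le> 2 * wt w (ix 0 :: 'n)"
    and F: "F \<in> lmeasurable"
    and agree: "\<And>x y. \<lbrakk>x \<in> cyl w - F; y \<in> cyl w - F; height x = height y; height x \<le> 8 * t\<rbrakk>
      \<Longrightarrow> x \<in> V \<longleftrightarrow> y \<in> V"
    and B: "B = fact CARD('n) * 2 ^ CARD('n)"
  shows "measure lebesgue ({z \<in> moved \<mu>. height z \<le> t} \<inter> cyl w)
    \<le> (B + B * B + 2 * (B * (B * B))) * measure lebesgue (F \<inter> cyl w)"
proof -
  define a f :: 'n where "a = ix 0" and "f = ix 1"
  have af: "a \<noteq> f" using two by (simp add: a_def f_def ix_eq_iff)
  define l where "l z = height (Phi w z)" for z :: "real ^ 'n::_"
  define c :: "'n \<Rightarrow> real" where "c = wt w"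
  \<comment> \<open>The shear adds \<open>c a\<close> times the sum of the coordinates other than
    \<open>a\<close> to \<open>l\<close>. Hence \<open>h\<close> satisfies \<open>l h = 0\<close>
    and \<open>l (shear h) = 1\<close>, so that \<open>\<rho>\<close> keeps \<open>l\<close> and
    multiplies \<open>l \<circ> shear\<close> by \<open>\<mu>\<close>. The maps
    \<open>\<rho>'\<close>, \<open>N'\<close> and \<open>\<mu>'\<close> undo \<open>\<rho>\<close>,
    the shear and the scaling.\<close>
  define h where "h = (1 / c a) *\<^sub>R axis f 1 - (c f / (c a)\<^sup>2) *\<^sub>R axis a (1::real)"
  define \<rho> where "\<rho> z = z + ((\<mu> - 1) * l (shear z)) *\<^sub>R h" for z
  define \<rho>' where "\<rho>' z = z - ((1 - 1 / \<mu>) * l (shear z)) *\<^sub>R h" for z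
  define N' where "N' z = z - (height z - z $ a) *\<^sub>R axis a 1" for z :: "real ^ 'n::_"
  define \<mu>' where "\<mu>' z = (1 / \<mu>) *\<^sub>R z" for z :: "real ^ 'n::_"
  have c: "0 < c a" "c a \<le> c i" "c i \<le> 2 * c a" for i
    using wt_pos[OF two] wt_ge[OF two] bal by (auto simp: c_def a_def)
  have lin_l: "linear l"
    unfolding l_def using linear_compose[OF linear_Phi linear_height] by (simp add: o_def)
  have l_sum: "l z = (\<Sum>i\<in>UNIV. z $ i * c i)" for z
    by (simp add: l_def c_def height_Phi)
  have l_axis: "l (axis i 1) = c i" for i
    by (simp add: l_def c_def wt_def)
  have height_axis: "height (axis i 1 :: real ^ 'n::_) = 1" for i
    by (simp add: height_def axis_def)
  have shear_eq: "shear z = z + (height z - z $ a) *\<^sub>R axis a 1" for z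
    by (simp add: shear_def a_def)
  note lin_simps = linear_add[OF lin_l] linear_diff[OF lin_l] linear_scale[OF lin_l]
    linear_add[OF linear_height] linear_diff[OF linear_height] linear_scale[OF linear_height]
  have lin_shear: "linear (shear :: real ^ 'n::_ \<Rightarrow> _)"
    by (intro linearI) (simp_all add: shear_eq lin_simps algebra_simps)
  note lin_simps' = lin_simps linear_add[OF lin_shear] linear_diff[OF lin_shear] linear_scale[OF lin_shear]
  have l_shear: "l (shear z) = l z + c a * (height z - z $ a)" for z
    by (simp add: shear_eq lin_simps l_axis)
  have lh: "l h = 0"
    using c(1) by (simp add: h_def lin_simps l_axis power2_eq_square)
  have lNh: "l (shear h) = 1"
  proof -
    have "height h = 1 / c a - c f / (c a)\<^sup>2"
      by (simp add: h_def lin_simps height_axis)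
    moreover have "h $ a = - (c f / (c a)\<^sup>2)"
      using af by (simp add: h_def axis_def)
    ultimately show ?thesis
      using c(1) by (simp add: l_shear lh)
  qed
  have l_rho: "l (\<rho> z) = l z" for z
    by (simp add: \<rho>_def lin_simps lh)
  have l_shear_rho: "l (shear (\<rho> z)) = \<mu> * l (shear z)" for z
    by (simp add: \<rho>_def lin_simps' lNh algebra_simps)
  have inv_rho: "\<rho>' (\<rho> z) = z" for z
  proof -
    have "\<rho>' (\<rho> z) = z + ((\<mu> - 1) * l (shear z) - (1 - 1 / \<mu>) * (\<mu> * l (shear z))) *\<^sub>R h"
      unfolding \<rho>'_def l_shear_rho by (simp add: \<rho>_def scaleR_left_diff_distrib)
    also have "(\<mu> - 1) * l (shear z) - (1 - 1 / \<mu>) * (\<mu> * l (shear z)) = 0"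
      using \<mu> by (simp add: field_simps)
    finally show ?thesis by simp
  qed
  have inv_shear: "N' (shear z) = z" for z
    by (simp add: N'_def shear_eq lin_simps height_axis)
  have inv_scale: "\<mu>' (\<mu> *\<^sub>R z) = z" for z
    using \<mu> by (simp add: \<mu>'_def)

  have lin: "linear N'" "linear \<rho>'" "linear \<mu>'"
    unfolding N'_def \<rho>'_def \<mu>'_def
    by (intro linearI; simp add: lin_simps' algebra_simps)+
  have N'_entries: "\<bar>N' (axis i 1) $ k\<bar> \<le> 2" for i k
    by (simp add: N'_def height_axis) (simp add: axis_def)
  have \<mu>'_entries: "\<bar>\<mu>' (axis i 1) $ k\<bar> \<le> 2" for i k
    using \<mu> by (auto simp: \<mu>'_def axis_def field_simps)
  have \<rho>'_entries: "\<bar>\<rho>' (axis i 1) $ k\<bar> \<le> 2" for i k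
  proof -
    have 1: "0 \<le> 1 - 1 / \<mu>" "1 - 1 / \<mu> \<le> 1 / 32"
      using \<mu> by (auto simp: field_simps)
    have "l (shear (axis i 1)) = c i + c a * (1 - axis i 1 $ a)"
      by (simp add: l_shear l_axis height_axis)
    moreover have "0 \<le> (1::real) - axis i 1 $ a \<and> 1 - axis i 1 $ a \<le> (1::real)" by (simp add: axis_def)
    then have "0 \<le> c a * (1 - axis i 1 $ a)" "c a * (1 - axis i 1 $ a) \<le> c a"
      using c(1) by (auto simp: mult_le_cancel_left1 intro!: mult_nonneg_nonneg)
    ultimately have 2: "0 \<le> l (shear (axis i 1))" "l (shear (axis i 1)) \<le> 3 * c a"
      using c(1) c(2,3)[of i] by linarith+
    have 3: "\<bar>h $ k\<bar> \<le> 2 / c a"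
    proof -
      have "\<bar>1 / c a\<bar> \<le> 2 / c a" "\<bar>c f / (c a)\<^sup>2\<bar> \<le> 2 / c a"
        using c(1) c(2,3)[of f] by (simp_all add: field_simps power2_eq_square)
      then show ?thesis
        using af c(1) by (auto simp: h_def axis_def)
    qed
    have "\<bar>((1 - 1 / \<mu>) * l (shear (axis i 1))) * h $ k\<bar> \<le> (1 / 32 * (3 * c a)) * (2 / c a)"
      unfolding abs_mult using 1 2 3 c(1) by (intro mult_mono) auto
    also have "\<dots> \<le> 1" using c(1) by simp
    finally have "\<bar>((1 - 1 / \<mu>) * l (shear (axis i 1))) * h $ k\<bar> \<le> 1" .
    moreover have "\<bar>axis i 1 $ k\<bar> \<le> (1::real)" by (simp add: axis_def)
    ultimately show ?thesis
      by (simp add: \<rho>'_def abs_le_iff)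
  qed
  note images = bounded_linear_entries_image[OF lin(1) N'_entries]
    bounded_linear_entries_image[OF lin(2) \<rho>'_entries]
    bounded_linear_entries_image[OF lin(3) \<mu>'_entries]

  \<comment> \<open>The comparison takes place in the orthant, where the maps above have bounded
    entries; \<open>S\<close> and \<open>E\<close> are the pullbacks of the two sets to be
    compared.\<close>
  obtain G :: "real ^ 'n::_ \<Rightarrow> real ^ 'n::_" where G: "linear G" "G \<circ> Phi w = id"
    using linear_injective_left_inverse[OF linear_Phi inj_Phi[OF two]] by blast
  then have G': "G (Phi w z) = z" for z by (metis comp_apply id_apply)
  define S :: "(real ^ 'n::_) set" where "S = {z \<in> orthant. l z \<le> t \<and> z \<in> moved \<mu>}"
  define E :: "(real ^ 'n::_) set" where "E = {z \<in> orthant. Phi w z \<in> F}"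
  have "(cyl w :: (real ^ 'n::_) set) \<in> sets lebesgue" using open_cyl[OF two] by auto
  have FE: "Phi w ` E = F \<inter> cyl w" by (auto simp: E_def cyl_def)
  have SE: "Phi w ` S = {z \<in> moved \<mu>. height z \<le> t} \<inter> cyl w"
    using \<mu> by (auto simp: S_def cyl_def l_def moved_Phi)
  have "E = G ` (F \<inter> cyl w)" unfolding FE[symmetric] image_comp using G by simp
  then have E_lm: "E \<in> lmeasurable"
    using F \<open>cyl w \<in> sets lebesgue\<close> by (auto intro!: measurable_linear_image G fmeasurable_Int_fmeasurable)
  have "{z \<in> moved \<mu>. height z \<le> t} \<in> lmeasurable"
    using \<mu> by (intro sublevel_lmeasurable[where c = 1] moved_sets linear_height) (auto simp: moved_def)
  moreover have "S = G ` ({z \<in> moved \<mu>. height z \<le> t} \<inter> cyl w)"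
    unfolding SE[symmetric] image_comp using G by simp
  ultimately have S_lm: "S \<in> lmeasurable"
    using \<open>cyl w \<in> sets lebesgue\<close> by (auto intro!: measurable_linear_image G fmeasurable_Int_fmeasurable)

  have orthant_shear: "shear z \<in> orthant" if "z \<in> orthant" for z :: "real ^ 'n::_"
    using Phi_orthant[OF two that] Phi_replicate_False[OF two] by metis
  have s_bound: "0 < height z - z $ a" "c a * (height z - z $ a) \<le> l z" "l z \<le> 2 * c a * height z"
    if z: "z \<in> orthant" for z :: "real ^ 'n::_"
  proof -
    have eq: "height z - z $ a = (\<Sum>i\<in>UNIV - {a}. z $ i)"
      by (simp add: height_def sum_diff1)
    show "0 < height z - z $ a" unfolding eq
      using z af by (intro sum_pos) (auto simp: orthant_def)
    have "c a * (height z - z $ a) \<le> c a * height z"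
      using z c(1) by (auto simp: orthant_def less_imp_le)
    also have "c a * height z = (\<Sum>i\<in>UNIV. z $ i * c a)"
      by (simp add: height_def sum_distrib_left mult.commute)
    also have "\<dots> \<le> l z"
      unfolding l_sum using z c by (intro sum_mono mult_left_mono) (auto simp: orthant_def less_imp_le)
    finally show "c a * (height z - z $ a) \<le> l z" .
    have "l z \<le> (\<Sum>i\<in>UNIV. z $ i * (2 * c a))"
      unfolding l_sum using z c by (intro sum_mono mult_left_mono) (auto simp: orthant_def less_imp_le)
    then show "l z \<le> 2 * c a * height z"
      by (simp add: height_def sum_distrib_left mult_ac)
  qed
  have l_shear_le: "l (shear z) \<le> 2 * l z" if "z \<in> orthant" for z
    using s_bound[OF that] by (simp add: l_shear)
  have agree': "x \<in> V \<longleftrightarrow> y \<in> V" if "x \<in> orthant - E" "y \<in> orthant - E" "l x = l y" "l x \<le> 8 * t" for x y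
    using agree[of "Phi w x" "Phi w y"] that V_Phi by (auto simp: E_def cyl_def l_def)
  \<comment> \<open>Outside these four sets, \<open>x = shear z\<close>, \<open>\<rho> x\<close>,
    \<open>shear (\<rho> x)\<close> and \<open>\<mu> *\<^sub>R shear x\<close> all avoid
    \<open>E\<close>. The first two share a value of \<open>l\<close>, as do the last two, and the
    shear links the pairs.\<close>
  have sub: "S \<subseteq> (N' ` E \<union> N' ` \<rho>' ` E) \<union> (N' ` \<rho>' ` N' ` E \<union> N' ` N' ` \<mu>' ` E)"
  proof
    fix z assume "z \<in> S"
    then have z: "z \<in> orthant" "l z \<le> t" "(z \<in> V) \<noteq> (\<mu> *\<^sub>R z \<in> V)"
      by (auto simp: S_def moved_def)
    \<comment> \<open>One preliminary shear makes coordinate \<open>a\<close> equal to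
      \<open>height z\<close>, large enough to stay positive when \<open>\<rho>\<close> subtracts
      from it.\<close>
    define x where "x = shear z"
    have x: "x \<in> orthant" unfolding x_def by (rule orthant_shear[OF z(1)])
    have lx: "l x \<le> 2 * t" "l (shear x) \<le> 4 * t" "0 \<le> l (shear x)"
      using l_shear_le[OF z(1)] l_shear_le[OF x] z(2) s_bound[OF orthant_shear[OF x]] c(1)
      by (auto simp: x_def intro: order_trans[rotated] mult_nonneg_nonneg)
    have xa: "x $ a = height z" by (simp add: x_def shear_eq)
    have rx: "\<rho> x \<in> orthant"
      unfolding orthant_def
    proof (intro CollectI allI)
      fix i
      have pos: "0 < x $ i" for i using x by (simp add: orthant_def)
      consider "i = a" | "i = f" | "i \<noteq> a" "i \<noteq> f" by blast
      then show "0 < \<rho> x $ i"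
      proof cases
        case 1
        have "l (shear x) \<le> 8 * c a * height z"
          using l_shear_le[OF z(1)] l_shear_le[OF x] s_bound(3)[OF z(1)] by (simp add: x_def)
        \<comment> \<open>Origin of the bound 33/32: with \<open>\<mu> - 1 \<le> 1 / 32\<close> and
          \<open>c f \<le> 2 * c a\<close>, at most half of coordinate \<open>a\<close> is
          subtracted.\<close>
        then have "((\<mu> - 1) * l (shear x)) * c f \<le> (1 / 32 * (8 * c a * height z)) * (2 * c a)"
          using \<mu> lx c(1) c(2,3)[of f] pos[of a] xa by (intro mult_mono) auto
        also have "\<dots> < (c a)\<^sup>2 * height z"
          using c(1) pos[of a] xa by (simp add: power2_eq_square)
        finally have "((\<mu> - 1) * l (shear x)) * (c f / (c a)\<^sup>2) < height z"
          using c(1) by (simp add: field_simps)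
        then show ?thesis
          using af by (simp add: \<rho>_def h_def 1 xa axis_def)
      next
        case 2
        then show ?thesis
          using \<mu> lx c(1) pos[of f] af by (simp add: \<rho>_def h_def axis_def add_pos_nonneg)
      next
        case 3
        then show ?thesis using pos[of i] by (simp add: \<rho>_def h_def axis_def)
      qed
    qed
    have lam: "\<mu> > 0" using \<mu> by simp
    show "z \<in> (N' ` E \<union> N' ` \<rho>' ` E) \<union> (N' ` \<rho>' ` N' ` E \<union> N' ` N' ` \<mu>' ` E)"
    proof (rule ccontr)
      assume "\<not> ?thesis"
      then have out: "z \<notin> N' ` E" "z \<notin> N' ` \<rho>' ` E" "z \<notin> N' ` \<rho>' ` N' ` E" "z \<notin> N' ` N' ` \<mu>' ` E"
        by blast+
      have nE: "x \<notin> E" "\<rho> x \<notin> E" "shear (\<rho> x) \<notin> E" "\<mu> *\<^sub>R shear x \<notin> E"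
        using out inv_shear inv_rho inv_scale unfolding x_def by (metis imageI)+
      have "x \<in> V \<longleftrightarrow> \<rho> x \<in> V"
        using agree'[of x "\<rho> x"] x rx nE lx t by (simp add: l_rho)
      also have "\<dots> \<longleftrightarrow> shear (\<rho> x) \<in> V"
        using V_shear[OF rx] by simp
      also have "\<dots> \<longleftrightarrow> \<mu> *\<^sub>R shear x \<in> V"
      proof (rule agree')
        show "shear (\<rho> x) \<in> orthant - E" "\<mu> *\<^sub>R shear x \<in> orthant - E"
          using nE rx x orthant_shear orthant_scaleR lam by auto
        show "l (shear (\<rho> x)) = l (\<mu> *\<^sub>R shear x)" by (simp add: l_shear_rho lin_simps)
        \<comment> \<open>Each of two shears at most doubles \<open>l\<close>, and
          \<open>\<mu> \<le> 2\<close>; this is why agreement is assumed up to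
          \<open>8 * t\<close>.\<close>
        have "\<mu> * l (shear x) \<le> 2 * (4 * t)"
          using \<mu> lx t by (intro mult_mono) auto
        then show "l (shear (\<rho> x)) \<le> 8 * t" by (simp add: l_shear_rho)
      qed
      also have "\<mu> *\<^sub>R shear x = shear (\<mu> *\<^sub>R x)" by (simp add: lin_simps')
      also have "\<dots> \<in> V \<longleftrightarrow> \<mu> *\<^sub>R x \<in> V"
        by (rule V_shear[OF orthant_scaleR[OF x lam]])
      also have "\<mu> *\<^sub>R x = shear (\<mu> *\<^sub>R z)" by (simp add: x_def lin_simps')
      also have "\<dots> \<in> V \<longleftrightarrow> \<mu> *\<^sub>R z \<in> V"
        by (rule V_shear[OF orthant_scaleR[OF z(1) lam]])
      finally show False using z(3) V_shear[OF z(1)] by (simp add: x_def)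
    qed
  qed
  let ?m = "measure lebesgue E"
  have i1: "N' ` E \<in> lmeasurable" "measure lebesgue (N' ` E) \<le> B * ?m"
    using images(1,2)[OF E_lm order_refl] unfolding B by auto
  have i2: "\<rho>' ` E \<in> lmeasurable" "measure lebesgue (\<rho>' ` E) \<le> B * ?m"
    using images(3,4)[OF E_lm order_refl] unfolding B by auto
  have i3: "\<mu>' ` E \<in> lmeasurable" "measure lebesgue (\<mu>' ` E) \<le> B * ?m"
    using images(5,6)[OF E_lm order_refl] unfolding B by auto
  have i4: "N' ` \<rho>' ` E \<in> lmeasurable" "measure lebesgue (N' ` \<rho>' ` E) \<le> B * (B * ?m)"
    using images(1,2)[OF i2] unfolding B by auto
  have i5: "\<rho>' ` N' ` E \<in> lmeasurable" "measure lebesgue (\<rho>' ` N' ` E) \<le> B * (B * ?m)"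
    using images(3,4)[OF i1] unfolding B by auto
  have i6: "N' ` \<mu>' ` E \<in> lmeasurable" "measure lebesgue (N' ` \<mu>' ` E) \<le> B * (B * ?m)"
    using images(1,2)[OF i3] unfolding B by auto
  have i7: "N' ` \<rho>' ` N' ` E \<in> lmeasurable" "measure lebesgue (N' ` \<rho>' ` N' ` E) \<le> B * (B * (B * ?m))"
    using images(1,2)[OF i5] unfolding B by auto
  have i8: "N' ` N' ` \<mu>' ` E \<in> lmeasurable" "measure lebesgue (N' ` N' ` \<mu>' ` E) \<le> B * (B * (B * ?m))"
    using images(1,2)[OF i6] unfolding B by auto
  have "measure lebesgue S \<le> measure lebesgue ((N' ` E \<union> N' ` \<rho>' ` E) \<union> (N' ` \<rho>' ` N' ` E \<union> N' ` N' ` \<mu>' ` E))"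
    using S_lm i1 i4 i7 i8 sub by (intro measure_mono_fmeasurable) auto
  also have "\<dots> \<le> (measure lebesgue (N' ` E) + measure lebesgue (N' ` \<rho>' ` E))
      + (measure lebesgue (N' ` \<rho>' ` N' ` E) + measure lebesgue (N' ` N' ` \<mu>' ` E))"
    using i1 i4 i7 i8 by (intro order_trans[OF measure_Un_le] add_mono measure_Un_le) auto
  also have "\<dots> \<le> (B * ?m + B * (B * ?m)) + (B * (B * (B * ?m)) + B * (B * (B * ?m)))"
    using i1 i4 i7 i8 by (intro add_mono) auto
  also have "\<dots> = (B + B * B + 2 * (B * (B * B))) * ?m"
    by (simp add: algebra_simps)
  finally have *: "measure lebesgue S \<le> (B + B * B + 2 * (B * (B * B))) * ?m" .
  have "measure lebesgue (Phi w ` S) \<le> (B + B * B + 2 * (B * (B * B))) * measure lebesgue (Phi w ` E)"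
    using mult_left_mono[OF *, of "\<bar>det (matrix (Phi w :: real ^ 'n::_ \<Rightarrow> _))\<bar>"]
    by (simp add: measure_linear_image[OF linear_Phi] S_lm E_lm mult_ac)
  then show ?thesis unfolding FE SE .
qed

end

section \<open>Invariance under scaling up to null sets\<close>

lemma sublevel_UN: "U = (\<Union>n::nat. {z \<in> U. f z \<le> real (Suc n)})"
proof -
  have "\<exists>n. f z \<le> real (Suc n)" for z
    using real_arch_simple[of "f z"] by (metis of_nat_Suc le_add_same_cancel2 order_trans zero_le_one)
  then show ?thesis by blast
qed

lemma bounded_sublevel: "bounded {z \<in> orthant. height z \<le> t}"
proof (rule boundedI)
  fix z :: "real ^ 'a" assume "z \<in> {z \<in> orthant. height z \<le> t}"
  then show "norm z \<le> t"
    using norm_le_height[of z] by (auto simp: orthant_def less_imp_le)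
qed

context step_invariant
begin

lemma moved_sub_orthant: "moved \<mu> \<subseteq> orthant"
  by (auto simp: moved_def)

lemma sublevel_height: "U \<in> sets lebesgue \<Longrightarrow> U \<subseteq> orthant \<Longrightarrow> {z \<in> U. height z \<le> t} \<in> lmeasurable"
  for U :: "(real ^ 'n::_) set"
  by (rule sublevel_lmeasurable[where c = 1]) (auto intro: linear_height)

lemma negligible_moved_small:
  assumes \<mu>: "1 < \<mu>" "\<mu> \<le> 33 / 32"
  shows "negligible (moved \<mu>)"
proof -
  have "negligible {z \<in> moved \<mu>. height z \<le> t}" if t: "t > 0" for t
  proof -
    let ?S = "{z \<in> moved \<mu>. height z \<le> t}"
    let ?X = "{z \<in> orthant. height z \<le> 8 * t} :: (real ^ 'n::_) set"
    define B :: real where "B = fact CARD('n) * 2 ^ CARD('n)"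
    define C where "C = B + B * B + 2 * (B * (B * B))"
    have "B > 0" by (simp add: B_def)
    then have C: "C > 0" by (simp add: C_def add_pos_pos)
    have S: "?S \<in> lmeasurable"
      using \<mu> by (intro sublevel_height moved_sets moved_sub_orthant) auto
    have X: "?X \<in> lmeasurable"
      using orthant_lebesgue by (intro sublevel_height) auto
    have bX: "bounded ?X"
      by (rule bounded_sublevel)
    have "measure lebesgue ?S \<le> 0 + \<epsilon>" if "\<epsilon> > 0" for \<epsilon>
    proof -
      have "\<epsilon> / C > 0" using \<open>\<epsilon> > 0\<close> C by simp
      obtain F \<delta> where F: "F \<in> lmeasurable" "F \<subseteq> ?X" "measure lebesgue F < \<epsilon> / C" "\<delta> > 0"
        "\<forall>x\<in>?X - F. \<forall>y\<in>?X - F. dist x y < \<delta> \<longrightarrow> (x \<in> V \<longleftrightarrow> y \<in> V)"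
        by (rule lusin_indicator[OF fmeasurableD[OF X] bX V_sets \<open>\<epsilon> / C > 0\<close>])
      \<comment> \<open>A cross-section of diameter \<open>\<delta> / (16 * t)\<close> at height 1
        has diameter at most \<open>\<delta> / 2\<close> at height \<open>8 * t\<close>.\<close>
      have "\<delta> / (16 * t) > 0" using F t by simp
      from narrow_partition[OF two this] obtain W where
        W: "disjoint_family_on (cyl :: _ \<Rightarrow> (real ^ 'n::_) set) W"
        "(limset :: (real ^ 'n::_) set) \<subseteq> (\<Union>w\<in>W. cyl w)"
        "\<And>w. w \<in> W \<Longrightarrow> narrow w (\<delta> / (16 * t)) TYPE('n)"
        "\<And>w i. w \<in> W \<Longrightarrow> wt w (i :: 'n) \<le> 2 * wt w (ix 0 :: 'n)"
        by blast
      have "measure lebesgue ?S \<le> C * measure lebesgue F"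
      proof (rule measure_le_by_pieces[OF _ W(1) _ S F(1)])
        show "countable W" by simp
        show "(cyl w :: (real ^ 'n::_) set) \<in> sets lebesgue" for w
          using open_cyl[OF two, of w] by auto
        have "?S - (\<Union>w\<in>W. cyl w) \<subseteq> orthant - limset"
          using W(2) by (auto simp: moved_def)
        then show "?S - (\<Union>w\<in>W. cyl w) \<in> null_sets lebesgue"
          using negligible_orthant_limset[OF two] negligible_subset by (auto simp: negligible_iff_null_sets)
        show "0 \<le> C" using C by simp
        fix w assume w: "w \<in> W"
        show "measure lebesgue (?S \<inter> cyl w) \<le> C * measure lebesgue (F \<inter> cyl w)"
          unfolding C_def
        proof (rule moved_piece[OF \<mu> t W(4)[OF w] F(1) _ B_def])
          fix x y :: "real ^ 'n::_"
          assume xy: "x \<in> cyl w - F" "y \<in> cyl w - F" "height x = height y" "height x \<le> 8 * t"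
          have "norm (x - y) \<le> height x * (\<delta> / (16 * t))"
            using narrow_dist[OF two W(3)[OF w], of x y] xy by simp
          also have "\<dots> \<le> 8 * t * (\<delta> / (16 * t))"
            using xy F(4) t by (intro mult_right_mono) auto
          also have "\<dots> < \<delta>" using F(4) t by simp
          finally have "dist x y < \<delta>" by (simp add: dist_norm)
          moreover have "x \<in> ?X - F" "y \<in> ?X - F"
            using xy cyl_subset_orthant[OF two, of w] by auto
          ultimately show "x \<in> V \<longleftrightarrow> y \<in> V"
            using F(5) by blast
        qed
      qed
      also have "\<dots> \<le> \<epsilon>" using F(3) C by (simp add: field_simps)
      finally show ?thesis by simp
    qed
    then have "measure lebesgue ?S \<le> 0" by (rule field_le_epsilon)
    then have "measure lebesgue ?S = 0" by (simp add: measure_le_0_iff)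
    then show ?thesis using S by (simp add: negligible_iff_measure)
  qed
  then have "negligible (\<Union>n::nat. {z \<in> moved \<mu>. height z \<le> real (Suc n)})"
    by (intro negligible_countable_Union) auto
  moreover have "moved \<mu> = (\<Union>n::nat. {z \<in> moved \<mu>. height z \<le> real (Suc n)})"
    by (rule sublevel_UN)
  ultimately show ?thesis by metis
qed

lemma negligible_scaleR_image: "negligible S \<Longrightarrow> negligible ((*\<^sub>R) c ` S)"
  for S :: "(real ^ 'n::_) set"
  by (intro negligible_linear_image linear_scaleR)

text \<open>The scalings that respect \<open>V\<close> up to null sets form a group: a point moved
  by a product is moved by one factor or, after scaling, by the other. The factors up to 33/32
  generate all of them.\<close>

lemma negligible_moved:
  assumes "\<mu> > 0"
  shows "negligible (moved \<mu>)"
proof -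
  have ge1: "negligible (moved \<mu>)" if "1 \<le> \<mu>" "\<mu> \<le> (33 / 32) ^ k" for k \<mu>
    using that
  proof (induction k arbitrary: \<mu>)
    case 0
    then have "moved \<mu> = {}" by (auto simp: moved_def)
    then show ?case by simp
  next
    case (Suc k)
    let ?r = "33 / 32 :: real"
    consider "\<mu> = 1" | "1 < \<mu>" "\<mu> \<le> ?r" | "?r < \<mu>" using Suc by linarith
    then show ?case
    proof cases
      case 1
      then have "moved \<mu> = {}" by (auto simp: moved_def)
      then show ?thesis by simp
    next
      case 2
      then show ?thesis by (rule negligible_moved_small)
    next
      case 3
      have "negligible (moved (\<mu> / ?r))"
        using 3 Suc.prems by (intro Suc.IH) (auto simp: field_simps)
      moreover have "moved \<mu> \<subseteq> moved ?r \<union> (*\<^sub>R) (1 / ?r) ` moved (\<mu> / ?r)"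
      proof
        fix z assume z: "z \<in> moved \<mu>"
        show "z \<in> moved ?r \<union> (*\<^sub>R) (1 / ?r) ` moved (\<mu> / ?r)"
        proof (cases "z \<in> moved ?r")
          case False
          then have "?r *\<^sub>R z \<in> moved (\<mu> / ?r)"
            using z orthant_scaleR[of z ?r] by (simp add: moved_def)
          moreover have "z = (1 / ?r) *\<^sub>R (?r *\<^sub>R z)" by simp
          ultimately show ?thesis by blast
        qed simp
      qed
      moreover have "negligible (moved ?r)" by (rule negligible_moved_small) auto
      ultimately show ?thesis
        using negligible_scaleR_image negligible_Un negligible_subset by blast
    qed
  qed
  have ge1': "negligible (moved \<mu>)" if "1 \<le> \<mu>" for \<mu>
    using real_arch_pow[of "33 / 32" \<mu>] ge1[OF that] less_imp_le by auto
  show ?thesis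
  proof (cases "1 \<le> \<mu>")
    case False
    have "moved \<mu> \<subseteq> (*\<^sub>R) (1 / \<mu>) ` moved (1 / \<mu>)"
    proof
      fix z assume "z \<in> moved \<mu>"
      then have "\<mu> *\<^sub>R z \<in> moved (1 / \<mu>)"
        using assms orthant_scaleR[of z \<mu>] by (simp add: moved_def)
      moreover have "z = (1 / \<mu>) *\<^sub>R (\<mu> *\<^sub>R z)" using assms by simp
      ultimately show "z \<in> (*\<^sub>R) (1 / \<mu>) ` moved (1 / \<mu>)" by blast
    qed
    moreover have "negligible (moved (1 / \<mu>))"
      using False assms by (intro ge1') simp
    ultimately show ?thesis using negligible_scaleR_image negligible_subset by blast
  qed (rule ge1')
qed

text \<open>The scaled unit sublevel set and the target differ only where scaling by
  \<open>s\<close> changes membership in \<open>V\<close>, which is a null set.\<close>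

lemma measure_sublevel_scale:
  fixes l :: "real ^ 'n::_ \<Rightarrow> real"
  assumes l: "linear l" "c > 0" "\<And>z. z \<in> orthant \<Longrightarrow> c * height z \<le> l z" and s: "s > 0"
  shows "measure lebesgue {z \<in> V. l z \<le> s} = s ^ CARD('n) * measure lebesgue {z \<in> V. l z \<le> 1}"
proof -
  have lm: "{z \<in> V. l z \<le> s} \<in> lmeasurable" for s
    by (rule sublevel_lmeasurable[OF V_sets V_orthant l])
  have lscale: "l (t *\<^sub>R z) = t * l z" for t z
    by (simp add: linear_scale[OF l(1)])
  let ?T = "(*\<^sub>R) s ` {z \<in> V. l z \<le> 1}"
  have "?T \<in> lmeasurable"
    by (intro measurable_linear_image linear_scaleR lm)
  moreover have "negligible ((?T - {z \<in> V. l z \<le> s}) \<union> ({z \<in> V. l z \<le> s} - ?T))"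
  proof (rule negligible_subset)
    show "negligible ((*\<^sub>R) s ` moved s)"
      by (intro negligible_scaleR_image negligible_moved s)
    have "y \<in> (*\<^sub>R) s ` moved s" if y: "y \<in> {z \<in> V. l z \<le> s} - ?T" for y
    proof -
      define x where "x = y /\<^sub>R s"
      have x: "y = s *\<^sub>R x" "l x \<le> 1" "x \<in> orthant"
        using s y V_orthant by (auto simp: x_def lscale field_simps intro: orthant_scaleR)
      then have "x \<in> moved s"
        using y by (auto simp: moved_def)
      then show ?thesis using x by blast
    qed
    moreover have "s *\<^sub>R z \<in> (*\<^sub>R) s ` moved s" if "z \<in> V" "l z \<le> 1" "\<not> (s *\<^sub>R z \<in> V \<and> l (s *\<^sub>R z) \<le> s)" for z
      using that s V_orthant by (intro imageI) (auto simp: moved_def lscale mult_le_cancel_left1)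
    ultimately show "(?T - {z \<in> V. l z \<le> s}) \<union> ({z \<in> V. l z \<le> s} - ?T) \<subseteq> (*\<^sub>R) s ` moved s"
      by blast
  qed
  ultimately have "measure lebesgue {z \<in> V. l z \<le> s} = measure lebesgue ?T"
    by (rule measure_negligible_symdiff)
  then show ?thesis
    using measure_scaleR_image[OF s] by simp
qed

end

section \<open>Density of homogeneous invariant sets in balanced cylinders, and the zero-one
  law\<close>

lemma orthant_step_invariant:
  assumes "2 \<le> CARD('n::{finite,wellorder})"
  shows "step_invariant (orthant :: (real ^ 'n::_) set)"
  using assms orthant_lebesgue step_orthant[OF assms] by unfold_locales auto

lemma (in step_invariant) compl_step_invariant: "step_invariant (orthant - V)"
  using two V_sets orthant_lebesgue V_step step_orthant[OF two] by unfold_locales auto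

context step_invariant
begin

lemma measure_shell:
  fixes l :: "real ^ 'n::_ \<Rightarrow> real"
  assumes l: "linear l" "c > 0" "\<And>z. z \<in> orthant \<Longrightarrow> c * height z \<le> l z" and s: "0 \<le> s" "s \<le> s'"
  shows "{z \<in> V. s < l z \<and> l z \<le> s'} \<in> lmeasurable"
    and "measure lebesgue {z \<in> V. s < l z \<and> l z \<le> s'}
      = (s' ^ CARD('n) - s ^ CARD('n)) * measure lebesgue {z \<in> V. l z \<le> 1}"
proof -
  have lm: "{z \<in> V. l z \<le> s} \<in> lmeasurable" for s
    by (rule sublevel_lmeasurable[OF V_sets V_orthant l])
  have eq: "{z \<in> V. s < l z \<and> l z \<le> s'} = {z \<in> V. l z \<le> s'} - {z \<in> V. l z \<le> s}"
    by auto
  show "{z \<in> V. s < l z \<and> l z \<le> s'} \<in> lmeasurable"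
    unfolding eq by (intro fmeasurable.Diff lm)
  have val: "measure lebesgue {z \<in> V. l z \<le> s} = s ^ CARD('n) * measure lebesgue {z \<in> V. l z \<le> 1}"
    if "0 \<le> s" for s
  proof (cases "s = 0")
    case True
    have "{z \<in> V. l z \<le> 0} = {}"
      using l(2,3) V_orthant height_pos by (force dest: mult_pos_pos)
    then have "measure lebesgue {z \<in> V. l z \<le> 0} = 0" by (metis measure_empty)
    then show ?thesis using True by simp
  next
    case False
    then show ?thesis using that l by (intro measure_sublevel_scale) auto
  qed
  have "measure lebesgue {z \<in> V. s < l z \<and> l z \<le> s'}
    = measure lebesgue {z \<in> V. l z \<le> s'} - measure lebesgue {z \<in> V. l z \<le> s}"
    unfolding eq by (rule measurable_measure_Diff) (use lm s in \<open>auto simp: fmeasurableD\<close>)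
  then show "measure lebesgue {z \<in> V. s < l z \<and> l z \<le> s'}
      = (s' ^ CARD('n) - s ^ CARD('n)) * measure lebesgue {z \<in> V. l z \<le> 1}"
    using val[of s] val[of s'] s by (simp add: left_diff_distrib)
qed

text \<open>Pulled back by \<open>Phi w\<close>, the shell is cut out by \<open>l\<close>, which
  lies between \<open>c * height\<close> and \<open>2 * c * height\<close>. By homogeneity
  \<open>V\<close> has measure at least \<open>(1 / (2 * c)) ^ d * u\<close> in
  \<open>l \<le> 1\<close>, the orthant at most \<open>(1 / c) ^ d * b\<close>; this yields the
  factor \<open>2 ^ d\<close>. The powers of \<open>s\<close> and \<open>s'\<close> and the
  determinant are common to both sides.\<close>

lemma measure_balanced_shell:
  assumes bal: "\<And>i :: 'n. wt w i \<le> 2 * wt w (ix 0 :: 'n)" and s: "0 \<le> s" "s \<le> s'"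
  shows "measure lebesgue {z \<in> V. height z \<le> 1} * measure lebesgue {z \<in> cyl w :: (real ^ 'n::_) set. s < height z \<and> height z \<le> s'}
    \<le> 2 ^ CARD('n) * measure lebesgue {z \<in> orthant :: (real ^ 'n::_) set. height z \<le> 1}
      * measure lebesgue {z \<in> V \<inter> cyl w. s < height z \<and> height z \<le> s'}"
proof -
  interpret O: step_invariant "orthant :: (real ^ 'n::_) set" by (rule orthant_step_invariant[OF two])
  define c where "c = wt w (ix 0 :: 'n)"
  define l :: "real ^ 'n::_ \<Rightarrow> real" where "l z = height (Phi w z)" for z
  define u where "u = measure lebesgue {z \<in> V. height z \<le> 1}"
  define b where "b = measure lebesgue {z \<in> orthant :: (real ^ 'n::_) set. height z \<le> 1}"
  have c: "c > 0" "\<And>i. c \<le> wt w (i :: 'n)"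
    using wt_pos[OF two] wt_ge[OF two] by (auto simp: c_def)
  have lin: "linear l"
    unfolding l_def using linear_compose[OF linear_Phi linear_height] by (simp add: o_def)
  have low: "c * height z \<le> l z" and up: "l z \<le> 2 * c * height z" if "z \<in> orthant" for z
    unfolding l_def height_Phi height_def[of z] sum_distrib_left
    using that c bal
    by (auto simp: orthant_def c_def mult.commute[of "_ * c"] mult.commute[of c] less_imp_le
        intro!: sum_mono mult_left_mono simp flip: mult.assoc)
  let ?d = "CARD('n)"
  have lm: "{z \<in> V. l z \<le> 1} \<in> lmeasurable" "{z \<in> orthant. l z \<le> 1} \<in> lmeasurable"
    using orthant_lebesgue by (intro sublevel_lmeasurable[OF _ _ lin c(1) low] V_sets V_orthant; simp)+
  have "(1 / (2 * c)) ^ ?d * u = measure lebesgue {z \<in> V. height z \<le> 1 / (2 * c)}"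
    unfolding u_def using c(1) by (intro measure_sublevel_scale[symmetric, where c = 1] linear_height) auto
  also have "\<dots> \<le> measure lebesgue {z \<in> V. l z \<le> 1}"
  proof (rule measure_mono_fmeasurable)
    show "{z \<in> V. height z \<le> 1 / (2 * c)} \<subseteq> {z \<in> V. l z \<le> 1}"
    proof safe
      fix z assume "z \<in> V" "height z \<le> 1 / (2 * c)"
      then show "l z \<le> 1" using up[of z] V_orthant c(1) by (auto simp: field_simps)
    qed
  qed (use lm sublevel_height[OF V_sets V_orthant] in \<open>auto simp: fmeasurableD\<close>)
  finally have 1: "u \<le> (2 * c) ^ ?d * measure lebesgue {z \<in> V. l z \<le> 1}"
    using c(1) by (simp add: field_simps power_divide power_mult_distrib)
  have "measure lebesgue {z \<in> orthant. l z \<le> 1} \<le> measure lebesgue {z \<in> orthant :: (real ^ 'n::_) set. height z \<le> 1 / c}"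
  proof (rule measure_mono_fmeasurable)
    show "{z \<in> orthant. l z \<le> 1} \<subseteq> {z \<in> orthant. height z \<le> 1 / c}"
    proof safe
      fix z :: "real ^ 'n::_" assume "z \<in> orthant" "l z \<le> 1"
      then show "height z \<le> 1 / c" using low[of z] c(1) by (auto simp: field_simps)
    qed
  qed (use lm sublevel_height[OF orthant_lebesgue] in \<open>auto simp: fmeasurableD\<close>)
  also have "\<dots> = (1 / c) ^ ?d * b"
    unfolding b_def using c(1) by (intro O.measure_sublevel_scale[where c = 1] linear_height) auto
  finally have 2: "c ^ ?d * measure lebesgue {z \<in> orthant. l z \<le> 1} \<le> b"
    using c(1) by (simp add: field_simps power_divide)
  have "u * (c ^ ?d * measure lebesgue {z \<in> orthant. l z \<le> 1})
    \<le> ((2 * c) ^ ?d * measure lebesgue {z \<in> V. l z \<le> 1}) * b"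
    using 1 2 c(1) by (intro mult_mono) auto
  then have 3: "u * measure lebesgue {z \<in> orthant. l z \<le> 1} \<le> 2 ^ ?d * b * measure lebesgue {z \<in> V. l z \<le> 1}"
    using c(1) by (simp add: power_mult_distrib mult_ac)
  let ?f = "s' ^ ?d - s ^ ?d"
  have f: "?f \<ge> 0" using s by (simp add: power_mono)
  have im: "{z \<in> cyl w :: (real ^ 'n::_) set. s < height z \<and> height z \<le> s'} = Phi w ` {z \<in> orthant. s < l z \<and> l z \<le> s'}"
    "{z \<in> V \<inter> cyl w. s < height z \<and> height z \<le> s'} = Phi w ` {z \<in> V. s < l z \<and> l z \<le> s'}"
    using V_Phi V_orthant by (auto simp: cyl_def l_def)
  have "u * measure lebesgue {z \<in> orthant. s < l z \<and> l z \<le> s'}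
      = ?f * (u * measure lebesgue {z \<in> orthant. l z \<le> 1})"
    using O.measure_shell(2)[OF lin c(1) low s] by simp
  also have "\<dots> \<le> ?f * (2 ^ ?d * b * measure lebesgue {z \<in> V. l z \<le> 1})"
    using 3 f by (rule mult_left_mono)
  also have "\<dots> = 2 ^ ?d * b * measure lebesgue {z \<in> V. s < l z \<and> l z \<le> s'}"
    using measure_shell(2)[OF lin c(1) low s] by simp
  finally have "u * measure lebesgue {z \<in> orthant. s < l z \<and> l z \<le> s'}
      \<le> 2 ^ ?d * b * measure lebesgue {z \<in> V. s < l z \<and> l z \<le> s'}" .
  from mult_left_mono[OF this, of "\<bar>det (matrix (Phi w :: real ^ 'n::_ \<Rightarrow> _))\<bar>"]
  have "u * measure lebesgue (Phi w ` {z \<in> orthant. s < l z \<and> l z \<le> s'})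
      \<le> 2 ^ ?d * b * measure lebesgue (Phi w ` {z \<in> V. s < l z \<and> l z \<le> s'})"
    by (simp add: measure_linear_image[OF linear_Phi] O.measure_shell(1)[OF lin c(1) low s]
        measure_shell(1)[OF lin c(1) low s] mult_ac)
  then show ?thesis unfolding im u_def b_def .
qed

lemma measure_unit_pos:
  assumes "\<not> negligible V"
  shows "0 < measure lebesgue {z \<in> V. height z \<le> 1}"
proof (rule ccontr)
  assume "\<not> ?thesis"
  then have 0: "measure lebesgue {z \<in> V. height z \<le> 1} = 0"
    by (simp add: zero_less_measure_iff)
  have "negligible {z \<in> V. height z \<le> real (Suc n)}" for n
    using measure_sublevel_scale[OF linear_height, of 1 "real (Suc n)"] 0
      sublevel_height[OF V_sets V_orthant] by (simp add: negligible_iff_measure)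
  then have "negligible (\<Union>n::nat. {z \<in> V. height z \<le> real (Suc n)})"
    by (intro negligible_countable_Union) auto
  moreover have "V = (\<Union>n::nat. {z \<in> V. height z \<le> real (Suc n)})"
    by (rule sublevel_UN)
  ultimately show False using assms by metis
qed

theorem negligible_or_conegligible: "negligible V \<or> negligible (orthant - V)"
proof (rule ccontr)
  assume contr: "\<not> ?thesis"
  interpret C: step_invariant "orthant - V" by (rule compl_step_invariant)
  let ?X = "{z \<in> orthant. height z \<le> 1} :: (real ^ 'n::_) set"
  define u where "u = min (measure lebesgue {z \<in> V. height z \<le> 1}) (measure lebesgue {z \<in> orthant - V. height z \<le> 1})"
  define b where "b = measure lebesgue ?X"
  have u: "u > 0"
    using contr measure_unit_pos C.measure_unit_pos by (simp add: u_def)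
  have X: "?X \<in> lmeasurable" using orthant_lebesgue by (intro sublevel_height) auto
  have bX: "bounded ?X"
    by (rule bounded_sublevel)
  have "u \<le> b"
    unfolding u_def b_def using V_orthant V_sets X sublevel_height[OF V_sets V_orthant]
    by (intro min.coboundedI1 measure_mono_fmeasurable) (auto simp: fmeasurableD)
  \<comment> \<open>Both \<open>V\<close> and its complement will fill at least the proportion
    \<open>1 / C\<close> of each piece below, while the Lusin set is taken smaller than
    \<open>b / C\<close>.\<close>
  define C where "C = 2 ^ CARD('n) * b / u"
  have b: "b > 0" and C: "C > 0" using u \<open>u \<le> b\<close> by (auto simp: C_def)
  have "b / C > 0" using b C by simp
  obtain F \<delta> where F: "F \<in> lmeasurable" "F \<subseteq> ?X" "measure lebesgue F < b / C" "\<delta> > 0"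
    "\<forall>x\<in>?X - F. \<forall>y\<in>?X - F. dist x y < \<delta> \<longrightarrow> (x \<in> V \<longleftrightarrow> y \<in> V)"
    by (rule lusin_indicator[OF fmeasurableD[OF X] bX V_sets \<open>b / C > 0\<close>])
  obtain n :: nat where n: "n > 0" "1 / real n < \<delta> / 2"
    using F(4) by (metis half_gt_zero nat_approx_posE zero_less_Suc)
  have "\<delta> / 2 > 0" using F(4) by simp
  from narrow_partition[OF two this] obtain W where
    W: "disjoint_family_on (cyl :: _ \<Rightarrow> (real ^ 'n::_) set) W"
    "(limset :: (real ^ 'n::_) set) \<subseteq> (\<Union>w\<in>W. cyl w)"
    "\<And>w. w \<in> W \<Longrightarrow> narrow w (\<delta> / 2) TYPE('n)"
    "\<And>w i. w \<in> W \<Longrightarrow> wt w (i :: 'n) \<le> 2 * wt w (ix 0 :: 'n)"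
    by blast
  \<comment> \<open>Narrowness controls directions only, so the cones are cut into shells of
    thickness \<open>1 / n\<close>. Directions and heights each contribute at most
    \<open>\<delta> / 2\<close>, the heights strictly less.\<close>
  define Q where "Q = (\<lambda>(w, k). {z \<in> cyl w :: (real ^ 'n::_) set. real k / n < height z \<and> height z \<le> real (Suc k) / n})"
  have Q_sub: "Q (w, k) \<subseteq> ?X" if "k < n" for w k
  proof -
    have "real (Suc k) / n \<le> 1" using that by (simp add: field_simps)
    then show ?thesis using cyl_subset_orthant[OF two, of w] by (auto simp: Q_def)
  qed
  have Q_sets: "Q (w, k) \<in> sets lebesgue" for w k
  proof -
    have "(cyl w :: (real ^ 'n::_) set) \<in> sets lebesgue" "cyl w \<subseteq> (orthant :: (real ^ 'n::_) set)"
      using open_cyl[OF two, of w] cyl_subset_orthant[OF two] by auto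
    then have "{z \<in> cyl w :: (real ^ 'n::_) set. height z \<le> t} \<in> sets lebesgue" for t
      by (rule fmeasurableD[OF sublevel_height])
    moreover have "Q (w, k) = {z \<in> cyl w. height z \<le> real (Suc k) / n} - {z \<in> cyl w. height z \<le> real k / n}"
      by (auto simp: Q_def)
    ultimately show ?thesis by auto
  qed
  have "measure lebesgue ?X \<le> C * measure lebesgue F"
  proof (rule measure_le_by_pieces[where I = "W \<times> {..<n}" and X = Q, OF _ _ _ X F(1)])
    show "countable (W \<times> {..<n})" by simp
    show "disjoint_family_on Q (W \<times> {..<n})"
      unfolding disjoint_family_on_def
    proof (intro ballI impI, rule ccontr)
      fix p q assume pq: "p \<in> W \<times> {..<n}" "q \<in> W \<times> {..<n}" "p \<noteq> q" "Q p \<inter> Q q \<noteq> {}"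
      obtain v k w k' where p: "p = (v, k)" "q = (w, k')" by fastforce
      obtain z where z: "z \<in> Q p" "z \<in> Q q" using pq by blast
      then have "v = w" using W(1) pq p by (fastforce simp: Q_def disjoint_family_on_def)
      moreover have "real k < real (Suc k')" "real k' < real (Suc k)"
        using z p n by (auto simp: Q_def divide_less_eq field_simps)
      then have "k = k'" by linarith
      ultimately show False using pq p by simp
    qed
    show "Q p \<in> sets lebesgue" for p using Q_sets by (cases p) auto
    have "?X - (\<Union>p\<in>W \<times> {..<n}. Q p) \<subseteq> orthant - limset"
    proof safe
      fix z :: "real ^ 'n::_"
      assume z: "z \<in> orthant" "height z \<le> 1" "z \<notin> (\<Union>p\<in>W \<times> {..<n}. Q p)" "z \<in> limset"
      then obtain w where w: "w \<in> W" "z \<in> cyl w" using W(2) by blast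
      \<comment> \<open>The shells contain their upper but not their lower boundary, hence the
        ceiling minus one; positivity of the height makes this nonnegative.\<close>
      define k where "k = nat (\<lceil>n * height z\<rceil> - 1)"
      have "0 < n * height z" "n * height z \<le> n" using z n height_pos[OF z(1)] by (auto simp: mult_le_cancel_left1)
      then have "k < n" "real k < n * height z" "n * height z \<le> real (Suc k)"
        unfolding k_def by linarith+
      then have "z \<in> Q (w, k)" using w n by (auto simp: Q_def field_simps)
      then show False using z w \<open>k < n\<close> by auto
    qed
    then show "?X - (\<Union>p\<in>W \<times> {..<n}. Q p) \<in> null_sets lebesgue"
      using negligible_orthant_limset[OF two] negligible_subset by (auto simp: negligible_iff_null_sets)
    show "0 \<le> C" using C by simp
    fix p assume "p \<in> W \<times> {..<n}"
    then obtain w k where p: "p = (w, k)" "w \<in> W" "k < n" by blast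
    define s where "s = real k / n"
    define s' where "s' = real (Suc k) / n"
    have s: "0 \<le> s" "s \<le> s'" "s' = s + 1 / n"
      using n by (auto simp: s_def s'_def divide_right_mono add_divide_distrib)
    have Qp: "Q p = {z \<in> cyl w :: (real ^ 'n::_) set. s < height z \<and> height z \<le> s'}"
      by (simp add: p Q_def s_def s'_def)
    have agree: "x \<in> V \<longleftrightarrow> y \<in> V" if "x \<in> Q p - F" "y \<in> Q p - F" for x y
    proof -
      have X: "x \<in> ?X - F" "y \<in> ?X - F" using that Q_sub[OF p(3), of w] p by auto
      have "norm (x - y) \<le> height x * (\<delta> / 2) + \<bar>height x - height y\<bar>"
        by (rule narrow_dist[OF two W(3)[OF p(2)]]) (use that Qp in auto)
      also have "height x * (\<delta> / 2) \<le> 1 * (\<delta> / 2)"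
        using X F(4) by (intro mult_right_mono) auto
      also have "\<bar>height x - height y\<bar> \<le> 1 / n"
        using that Qp s by auto
      finally have "dist x y < \<delta>" using n by (simp add: dist_norm)
      then show ?thesis using F(5) X by blast
    qed
    have part: "measure lebesgue (Q p) * u \<le> 2 ^ CARD('n) * b * measure lebesgue (U \<inter> Q p)"
      if "measure lebesgue {z \<in> U. height z \<le> 1} * measure lebesgue {z \<in> cyl w :: (real ^ 'n::_) set. s < height z \<and> height z \<le> s'}
        \<le> 2 ^ CARD('n) * b * measure lebesgue {z \<in> U \<inter> cyl w. s < height z \<and> height z \<le> s'}"
        "u \<le> measure lebesgue {z \<in> U. height z \<le> 1}" for U
    proof -
      have "measure lebesgue (Q p) * u \<le> measure lebesgue {z \<in> U. height z \<le> 1} * measure lebesgue (Q p)"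
        using mult_right_mono[OF that(2), of "measure lebesgue (Q p)"] by (simp add: mult.commute)
      also have "\<dots> \<le> 2 ^ CARD('n) * b * measure lebesgue {z \<in> U \<inter> cyl w. s < height z \<and> height z \<le> s'}"
        using that(1) by (simp add: Qp)
      also have "{z \<in> U \<inter> cyl w. s < height z \<and> height z \<le> s'} = U \<inter> Q p" by (auto simp: Qp)
      finally show ?thesis .
    qed
    have 1: "measure lebesgue (Q p) * u \<le> 2 ^ CARD('n) * b * measure lebesgue (V \<inter> Q p)"
      by (rule part) (use measure_balanced_shell[OF W(4)[OF p(2)] s(1,2)] in \<open>auto simp: b_def u_def\<close>)
    have 2: "measure lebesgue (Q p) * u \<le> 2 ^ CARD('n) * b * measure lebesgue ((orthant - V) \<inter> Q p)"
      by (rule part) (use C.measure_balanced_shell[OF W(4)[OF p(2)] s(1,2)] in \<open>auto simp: b_def u_def\<close>)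
    have Q1: "?X \<inter> Q p = Q p" "Q p \<in> sets lebesgue"
      using Q_sub[OF p(3)] Q_sets p by auto
    have FQ: "F \<inter> Q p \<in> lmeasurable" using F(1) Q1(2) by (rule fmeasurable_Int_fmeasurable)
    \<comment> \<open>Points of \<open>Q p\<close> outside \<open>F\<close> agree about
      \<open>V\<close>, so \<open>F\<close> swallows one of the two parts, and either part is a
      fixed proportion of \<open>Q p\<close>.\<close>
    have "V \<inter> Q p \<subseteq> F \<inter> Q p \<or> (orthant - V) \<inter> Q p \<subseteq> F \<inter> Q p"
      using agree by blast
    then have "measure lebesgue (V \<inter> Q p) \<le> measure lebesgue (F \<inter> Q p)
        \<or> measure lebesgue ((orthant - V) \<inter> Q p) \<le> measure lebesgue (F \<inter> Q p)"
      using FQ Q1(2) V_sets orthant_lebesgue by (auto intro!: measure_mono_fmeasurable)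
    then have "measure lebesgue (Q p) * u \<le> 2 ^ CARD('n) * b * measure lebesgue (F \<inter> Q p)"
    proof
      assume "measure lebesgue (V \<inter> Q p) \<le> measure lebesgue (F \<inter> Q p)"
      then show ?thesis by (intro order_trans[OF 1 mult_left_mono]) (use b in auto)
    next
      assume "measure lebesgue ((orthant - V) \<inter> Q p) \<le> measure lebesgue (F \<inter> Q p)"
      then show ?thesis by (intro order_trans[OF 2 mult_left_mono]) (use b in auto)
    qed
    then show "measure lebesgue (?X \<inter> Q p) \<le> C * measure lebesgue (F \<inter> Q p)"
      unfolding Q1(1) C_def using u by (simp add: field_simps)
  qed
  also have "\<dots> < C * (b / C)" using F(3) C by (intro mult_strict_left_mono)
  finally show False using C by (simp add: b_def)
qed

end

section \<open>Gap coordinates and the reduction to the absorbing cone\<close>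

lemma sort_vec_eqI:
  assumes y: "mono (\<lambda>i. y $ i)" and \<pi>: "bij \<pi>" "\<And>i. w $ i = y $ \<pi> i"
  shows "sort_vec w = (y :: real ^ 'n::{finite,wellorder})"
proof -
  let ?l = "sorted_list_of_set (UNIV :: 'n set)"
  have ml: "mset ?l = mset_set UNIV" using mset_set_set[of ?l] by simp
  have "image_mset (\<lambda>i. w $ i) (mset_set UNIV) = image_mset (\<lambda>i. y $ i) (image_mset \<pi> (mset_set UNIV))"
    by (simp add: \<pi>(2) image_mset.compositionality comp_def)
  also have "image_mset \<pi> (mset_set UNIV) = mset_set UNIV"
    using \<pi>(1) by (simp add: image_mset_mset_set bij_def)
  finally have "mset (map (\<lambda>j. y $ j) ?l) = mset (map (\<lambda>j. w $ j) ?l)"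
    by (simp add: ml)
  moreover have "sorted (map (\<lambda>j. y $ j) ?l)"
    unfolding sorted_map by (rule sorted_wrt_mono_rel[OF _ sorted_sorted_list_of_set]) (use y in \<open>auto simp: mono_def\<close>)
  ultimately have "sort (map (\<lambda>j. w $ j) ?l) = map (\<lambda>j. y $ j) ?l"
    by (rule properties_for_sort)
  then show ?thesis
    using nth_sorted_list_of_set_card_less[where 'n = 'n] card_less_lt_CARD[where 'n = 'n]
    by (simp add: sort_vec_def vec_eq_iff)
qed

definition last_minus_first :: "real ^ 'n::{finite,wellorder} \<Rightarrow> real ^ 'n::_" where
  "last_minus_first x = (\<chi> i. if i = Max UNIV then x $ Max UNIV - x $ Min UNIV else x $ i)"

lemma selmer_eq: "selmer x = sort_vec (last_minus_first x)"
  by (simp add: selmer_def last_minus_first_def)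

lemma range_sort_vec: "range (\<lambda>i. sort_vec w $ i) = range (\<lambda>i. w $ i)"
  using arg_cong[OF mset_sort_vec[of w], of set_mset] by simp

lemma height_sort_vec: "height (sort_vec w) = height w"
  using arg_cong[OF mset_sort_vec[of w], of sum_mset] by (simp add: height_def sum_unfold_sum_mset)

definition to_gaps :: "real ^ 'n::{finite,wellorder} \<Rightarrow> real ^ 'n::_" where
  "to_gaps y = (\<chi> i. if Suc (pos i) = CARD('n) then y $ ix 0 + y $ ix 1 - y $ i
     else y $ ix (Suc (pos i)) - y $ i)"

text \<open>Inverse of \<open>to_gaps\<close>: by telescoping, the height of the gap vector is
  \<open>y $ ix 1\<close>, and every other coordinate differs from it by a sum of gaps.\<close>

definition of_gaps :: "real ^ 'n::{finite,wellorder} \<Rightarrow> real ^ 'n::_" where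
  "of_gaps z = (\<chi> i. if pos i = 0 then height z - z $ i
     else height z + (\<Sum>q\<in>{1..<pos i}. z $ ix q))"

text \<open>The inverse branches of \<open>S\<close> in the original coordinates: the difference of
  last and first entry is \<open>y $ ix 0\<close> for \<open>True\<close> and
  \<open>y $ ix 1\<close> for \<open>False\<close>.\<close>

definition branch :: "bool \<Rightarrow> real ^ 'n::{finite,wellorder} \<Rightarrow> real ^ 'n::_" where
  "branch b y = (\<chi> i. if Suc (pos i) = CARD('n) then y $ ix 0 + y $ ix 1
     else if pos i = 0 then if b then y $ ix 1 else y $ ix 0
     else y $ ix (Suc (pos i)))"

definition absorbing :: "(real ^ 'n::{finite,wellorder}) set" where
  "absorbing = {x \<in> Sigma_cone. x $ Max UNIV \<le> x $ Min UNIV + x $ ix 1}"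

lemma linear_to_gaps: "linear to_gaps"
  by (intro linearI) (auto simp: to_gaps_def vec_eq_iff algebra_simps)

lemma linear_of_gaps: "linear of_gaps"
  by (intro linearI) (auto simp: of_gaps_def vec_eq_iff linear_add[OF linear_height]
      linear_scale[OF linear_height] sum.distrib sum_distrib_left algebra_simps)

lemma ix_mono: "\<lbrakk>k \<le> l; l < CARD('n)\<rbrakk> \<Longrightarrow> (ix k :: 'n::{finite,wellorder}) \<le> ix l"
  using pos_mono[of "ix k :: 'n" "ix l"] by simp

lemma Min_UNIV_ix: "Min UNIV = (ix 0 :: 'n::{finite,wellorder})"
proof (rule Min_eqI)
  show "ix 0 \<le> y" if "y \<in> UNIV" for y :: 'n
    using ix_mono[of 0 "pos y", where 'n = 'n] pos_less[of y] by simp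
qed auto

lemma Max_UNIV_ix: "Max UNIV = (ix (CARD('n) - 1) :: 'n::{finite,wellorder})"
proof (rule Max_eqI)
  show "y \<le> ix (CARD('n) - 1)" if "y \<in> UNIV" for y :: 'n
    using ix_mono[of "pos y" "CARD('n) - 1", where 'n = 'n] pos_less[of y] by simp
qed auto

lemma mono_vec_ix:
  fixes x :: "real ^ 'n::{finite,wellorder}"
  assumes "\<And>k. Suc k < CARD('n) \<Longrightarrow> x $ ix k \<le> x $ ix (Suc k)"
  shows "mono (\<lambda>i. x $ i)"
proof (rule monoI)
  have le: "x $ ix k \<le> x $ ix l" if "k \<le> l" "l < CARD('n)" for k l
    using that by (induction rule: dec_induct) (auto intro: order_trans assms)
  show "x $ i \<le> x $ j" if "i \<le> j" for i j
    using le[of "pos i" "pos j"] that pos_less[of j] by (simp add: pos_mono)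
qed

context
  assumes two: "2 \<le> CARD('n::{finite,wellorder})"
begin

lemma of_gaps_to_gaps: "of_gaps (to_gaps y) = (y :: real ^ 'n::_)"
proof -
  let ?d = "CARD('n)"
  have tele: "(\<Sum>q\<in>{a..<b}. to_gaps y $ ix q) = y $ ix b - y $ ix a" if "a \<le> b" "b < ?d" for a b
    using that
  proof (induction rule: dec_induct)
    case (step b)
    then show ?case by (simp add: to_gaps_def)
  qed simp
  have "height (to_gaps y) = (\<Sum>q\<in>{0..<?d - 1}. to_gaps y $ ix q) + to_gaps y $ ix (?d - 1)"
    using two unfolding height_def sum_ix
    by (metis Suc_diff_1 atLeast0LessThan lessThan_Suc_atMost pos2 order_less_le_trans sum.lessThan_Suc)
  also have "\<dots> = y $ ix 1"
    using tele[of 0 "?d - 1"] two by (simp add: to_gaps_def)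
  finally have h: "height (to_gaps y) = y $ ix 1" .
  have "of_gaps (to_gaps y) $ ix k = y $ ix k" if "k < ?d" for k
    using that tele[of 1 k] two h by (cases "k = 0") (auto simp: of_gaps_def, auto simp: to_gaps_def)
  then show ?thesis by (simp add: vec_eq_ix)
qed

lemma to_gaps_of_gaps: "to_gaps (of_gaps z) = (z :: real ^ 'n::_)"
proof -
  have "inj (to_gaps :: real ^ 'n::_ \<Rightarrow> _)"
    by (metis injI of_gaps_to_gaps)
  then have "surj (to_gaps :: real ^ 'n::_ \<Rightarrow> _)"
    by (rule linear_inj_imp_surj[OF linear_to_gaps])
  then obtain y where "z = to_gaps y" by (metis surjD)
  then show ?thesis by (simp add: of_gaps_to_gaps)
qed

lemma to_gaps_branch: "to_gaps (branch b y) = step b (to_gaps (y :: real ^ 'n::_))"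
proof -
  let ?d = "CARD('n)"
  have "to_gaps (branch b y) $ ix k = step b (to_gaps y) $ ix k" if k: "k < ?d" for k
  proof (cases "?d = 2")
    case True
    then have "k = 0 \<or> k = 1" using k by auto
    then show ?thesis using True by (auto simp: to_gaps_def branch_def step_def)
  next
    case False
    then have d: "?d \<ge> 3" using two by simp
    consider "k = 0" | "Suc k = ?d" | "k \<noteq> 0" "Suc k < ?d" using k by (metis Suc_lessI)
    then show ?thesis
    proof cases
      case 1
      then show ?thesis using d by (auto simp: to_gaps_def branch_def step_def numeral_2_eq_2)
    next
      case 2
      then show ?thesis using d by (auto simp: to_gaps_def branch_def step_def numeral_2_eq_2)
    next
      case 3
      then show ?thesis using d by (auto simp: to_gaps_def branch_def step_def)
    qed
  qed
  then show ?thesis by (simp add: vec_eq_ix)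
qed

lemma gaps_nonneg_Sigma:
  assumes "\<And>i. 0 \<le> to_gaps x $ i"
  shows "x \<in> (Sigma_cone :: (real ^ 'n::_) set)"
proof -
  have m: "mono (\<lambda>i. x $ i)"
  proof (rule mono_vec_ix)
    show "x $ ix k \<le> x $ ix (Suc k)" if "Suc k < CARD('n)" for k
      using assms[of "ix k"] that by (simp add: to_gaps_def)
  qed
  have "x $ ix 1 \<le> x $ ix (CARD('n) - 1)"
    using two by (intro monoD[OF m] ix_mono) auto
  moreover have "0 \<le> x $ ix 0 + x $ ix 1 - x $ ix (CARD('n) - 1)"
    using assms[of "ix (CARD('n) - 1)"] two by (simp add: to_gaps_def)
  ultimately show ?thesis
    using m by (simp add: Sigma_cone_def Min_UNIV_ix)
qed

lemma absorbing_gaps: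
  assumes "x \<in> (absorbing :: (real ^ 'n::_) set)"
  shows "0 \<le> to_gaps x $ i"
proof -
  have m: "mono (\<lambda>i. x $ i)" using assms by (simp add: absorbing_def Sigma_cone_def)
  have "x $ i \<le> x $ ix (Suc (pos i))" if "Suc (pos i) < CARD('n)"
    using that ix_mono[of "pos i" "Suc (pos i)", where 'n = 'n] by (intro monoD[OF m]) simp
  moreover have "i = ix (CARD('n) - 1)" if "Suc (pos i) = CARD('n)"
    using that by (metis diff_Suc_1 ix_pos)
  ultimately show ?thesis
    using assms pos_less[of i] by (auto simp: to_gaps_def absorbing_def Min_UNIV_ix Max_UNIV_ix)
qed

lemma selmer_branch:
  assumes "mono (\<lambda>i. y $ i)"
  shows "selmer (branch b y) = (y :: real ^ 'n::_)"
proof -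
  let ?d = "CARD('n)"
  \<comment> \<open>Rank in \<open>y\<close> of the entry at position \<open>k\<close> before
    sorting: the difference, placed last, is smallest for \<open>True\<close> and second smallest
    for \<open>False\<close>.\<close>
  define \<sigma> where "\<sigma> k = (if Suc k = ?d then if b then 0 else 1 else if k = 0 \<and> \<not> b then 0 else Suc k)" for k
  have "inj_on \<sigma> {..<?d}" "\<sigma> ` {..<?d} \<subseteq> {..<?d}"
    using two by (auto simp: \<sigma>_def inj_on_def split: if_splits)
  then have "bij_betw \<sigma> {..<?d} {..<?d}"
    by (simp add: bij_betw_def endo_inj_surj)
  moreover have "bij_betw (pos :: 'n \<Rightarrow> nat) UNIV {..<?d}"
    by (rule bij_betwI[where g = ix]) (auto simp: pos_less)
  ultimately have "bij_betw (ix \<circ> \<sigma> \<circ> pos) (UNIV :: 'n set) (UNIV :: 'n set)"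
    using bij_betw_ix by (meson bij_betw_trans comp_assoc)
  then show ?thesis
    unfolding selmer_eq
  proof (rule sort_vec_eqI[OF assms])
    fix i :: 'n
    have "last_minus_first (branch b y) $ ix k = y $ ix (\<sigma> k)" if "k < ?d" for k
      using that two
      by (auto simp: last_minus_first_def branch_def \<sigma>_def Min_UNIV_ix Max_UNIV_ix ix_eq_iff split: if_splits)
    from this[of "pos i"] show "last_minus_first (branch b y) $ i = y $ (ix \<circ> \<sigma> \<circ> pos) i"
      using pos_less[of i] by simp
  qed
qed

text \<open>Once it is known where each unsorted entry reappears, \<open>x\<close> is a linear
  function of \<open>selmer x\<close>, the last coordinate being the difference plus the first.
  Finitely many index maps \<open>\<sigma>\<close> cover all cases.\<close>

lemma negligible_selmer_vimage:
  assumes "negligible N"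
  shows "negligible (selmer -` N :: (real ^ 'n::_) set)"
proof -
  define g where "g \<sigma> y = (\<chi> i. if i = Max UNIV then y $ \<sigma> (Max UNIV) + y $ \<sigma> (Min UNIV) else y $ \<sigma> i)"
    for \<sigma> :: "'n \<Rightarrow> 'n" and y :: "real ^ 'n::_"
  have "linear (g \<sigma>)" for \<sigma>
    by (intro linearI) (auto simp: g_def vec_eq_iff algebra_simps)
  then have "negligible (\<Union>\<sigma>. g \<sigma> ` N)"
    using assms by (intro negligible_Union) (auto intro: negligible_linear_image)
  moreover have "selmer -` N \<subseteq> (\<Union>\<sigma>. g \<sigma> ` N)"
  proof
    fix x :: "real ^ 'n::_" assume x: "x \<in> selmer -` N"
    have "\<exists>j. last_minus_first x $ i = selmer x $ j" for i
      using range_sort_vec[of "last_minus_first x"] unfolding selmer_eq by (metis rangeE rangeI)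
    then obtain \<sigma> where \<sigma>: "\<And>i. last_minus_first x $ i = selmer x $ \<sigma> i" by metis
    have "Max UNIV \<noteq> (Min UNIV :: 'n)" using two by (simp add: Min_UNIV_ix Max_UNIV_ix ix_eq_iff)
    then have "x = g \<sigma> (selmer x)"
      by (auto simp: vec_eq_iff g_def last_minus_first_def simp flip: \<sigma>)
    then show "x \<in> (\<Union>\<sigma>. g \<sigma> ` N)" using x by blast
  qed
  ultimately show ?thesis by (rule negligible_subset)
qed

text \<open>Outside the absorbing cone the difference exceeds \<open>x[2]\<close>, so the smallest
  coordinate is kept while the sum drops by it. A nonnegative sum cannot drop by the same positive
  amount forever.\<close>

lemma reach_absorbing:
  assumes x: "x \<in> Sigma_cone" "0 < x $ ix 0"
  shows "\<exists>n. (selmer ^^ n) x \<in> (absorbing :: (real ^ 'n::_) set)"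
proof (rule ccontr)
  assume "\<nexists>n. (selmer ^^ n) x \<in> absorbing"
  then have no: "(selmer ^^ n) x \<notin> absorbing" for n by blast
  have neq: "Max UNIV \<noteq> (Min UNIV :: 'n)" using two by (simp add: Min_UNIV_ix Max_UNIV_ix ix_eq_iff)
  have one: "selmer y $ ix 0 = y $ ix 0" "height (selmer y) = height y - y $ ix 0"
    if y: "y \<in> Sigma_cone" "y \<notin> absorbing" for y :: "real ^ 'n::_"
  proof -
    let ?w = "last_minus_first y"
    have m: "y $ i \<le> y $ j" if "i \<le> j" for i j
      using y that by (auto simp: Sigma_cone_def mono_def)
    have first: "ix 0 \<le> i" for i :: 'n using Min_le[of UNIV i] by (simp add: Min_UNIV_ix)
    have ge: "y $ ix 0 \<le> ?w $ i" for i
    proof (cases "i = Max UNIV")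
      case True
      then show ?thesis
        using y m[OF first, of "ix 1"] by (auto simp: last_minus_first_def absorbing_def Min_UNIV_ix)
    qed (use m[OF first, of i] in \<open>simp add: last_minus_first_def\<close>)
    have w0: "?w $ ix 0 = y $ ix 0"
      using neq by (auto simp: last_minus_first_def Min_UNIV_ix)
    have "selmer y $ ix 0 \<in> range (\<lambda>i. ?w $ i)"
      using range_sort_vec[of ?w] unfolding selmer_eq by blast
    then have "y $ ix 0 \<le> selmer y $ ix 0" using ge by auto
    moreover have "?w $ ix 0 \<in> range (\<lambda>i. selmer y $ i)"
      using range_sort_vec[of ?w] unfolding selmer_eq by blast
    then obtain j where "y $ ix 0 = selmer y $ j" using w0 by auto
    then have "selmer y $ ix 0 \<le> y $ ix 0"
      using monoD[OF mono_sort_vec first, of ?w j] by (simp add: selmer_eq)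
    ultimately show "selmer y $ ix 0 = y $ ix 0" by simp
    have "?w = y - y $ ix 0 *\<^sub>R axis (Max UNIV) 1"
      by (auto simp: vec_eq_iff last_minus_first_def axis_def Min_UNIV_ix)
    then have "height ?w = height y - y $ ix 0 * height (axis (Max UNIV :: 'n) 1)"
      by (simp add: linear_diff[OF linear_height] linear_scale[OF linear_height])
    moreover have "height (axis (Max UNIV :: 'n) 1) = 1"
      by (simp add: height_def axis_def)
    ultimately show "height (selmer y) = height y - y $ ix 0"
      by (simp add: selmer_eq height_sort_vec)
  qed
  have "(selmer ^^ n) x \<in> Sigma_cone \<and> (selmer ^^ n) x $ ix 0 = x $ ix 0
      \<and> height ((selmer ^^ n) x) = height x - real n * x $ ix 0" for n
  proof (induction n)
    case (Suc n)
    then show ?case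
      using one[of "(selmer ^^ n) x"] no[of n] selmer_in_Sigma_cone[of "(selmer ^^ n) x"]
      by (simp add: algebra_simps)
  qed (use x in simp)
  moreover have "0 \<le> height y" if "y \<in> Sigma_cone" for y :: "real ^ 'n::_"
  proof -
    have "0 \<le> y $ i" for i
      using that Min_le[of UNIV i] by (auto simp: Sigma_cone_def mono_def intro: order_trans)
    then show ?thesis by (simp add: height_def sum_nonneg)
  qed
  ultimately have "real n * x $ ix 0 \<le> height x" for n
    by (metis diff_ge_0_iff_ge)
  then show False
    using reals_Archimedean3[OF x(2)] by (metis not_le)
qed

text \<open>Apart from the hyperplane \<open>x[1] = 0\<close>, every orbit in \<open>U\<close>
  enters the absorbing cone without leaving \<open>U\<close>, and iterated preimages of null sets
  are null.\<close>

lemma negligible_from_absorbing: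
  assumes U: "U \<subseteq> Sigma_cone" "selmer ` U \<subseteq> U" and neg: "negligible (U \<inter> absorbing)"
  shows "negligible (U :: (real ^ 'n::_) set)"
proof -
  have "negligible ((selmer ^^ n) -` (U \<inter> absorbing))" for n
  proof (induction n)
    case (Suc n)
    have "(selmer ^^ Suc n) -` (U \<inter> absorbing) = selmer -` ((selmer ^^ n) -` (U \<inter> absorbing))"
      by (simp add: funpow_swap1 vimage_comp comp_def del: funpow.simps add: funpow_Suc_right)
    then show ?case using negligible_selmer_vimage[OF Suc] by metis
  qed (use neg in simp)
  then have "negligible ((\<Union>n. (selmer ^^ n) -` (U \<inter> absorbing)) \<union> {x. x $ ix 0 = 0})"
    by (intro negligible_Un negligible_countable_Union negligible_standard_hyperplane_cart) auto
  moreover have "U \<subseteq> (\<Union>n. (selmer ^^ n) -` (U \<inter> absorbing)) \<union> {x. x $ ix 0 = 0}"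
  proof
    fix x assume x: "x \<in> U"
    have "(selmer ^^ n) x \<in> U" for n
      by (induction n) (use x U in auto)
    moreover have "0 \<le> x $ ix 0" using x U by (auto simp: Sigma_cone_def Min_UNIV_ix)
    ultimately show "x \<in> (\<Union>n. (selmer ^^ n) -` (U \<inter> absorbing)) \<union> {x. x $ ix 0 = 0}"
      using reach_absorbing[of x] x U by (cases "x $ ix 0 = 0") auto
  qed
  ultimately show ?thesis by (rule negligible_subset)
qed

text \<open>Gaps are nonnegative on the absorbing cone, and a vanishing gap confines the point to
  one of finitely many hyperplanes.\<close>

lemma negligible_absorbing_of_gaps:
  assumes "negligible (orthant \<inter> to_gaps ` U)"
  shows "negligible (U \<inter> absorbing :: (real ^ 'n::_) set)"
proof -
  have "negligible (of_gaps ` (orthant \<inter> to_gaps ` U) \<union> (\<Union>i. of_gaps ` {z :: real ^ 'n::_. z $ i = 0}))"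
    using assms by (intro negligible_Un negligible_linear_image linear_of_gaps negligible_Union)
      (auto intro!: negligible_linear_image linear_of_gaps negligible_standard_hyperplane_cart)
  moreover have "U \<inter> absorbing \<subseteq> of_gaps ` (orthant \<inter> to_gaps ` U) \<union> (\<Union>i. of_gaps ` {z :: real ^ 'n::_. z $ i = 0})"
  proof
    fix x assume x: "x \<in> U \<inter> absorbing"
    have eq: "x = of_gaps (to_gaps x)" by (simp add: of_gaps_to_gaps)
    show "x \<in> of_gaps ` (orthant \<inter> to_gaps ` U) \<union> (\<Union>i. of_gaps ` {z :: real ^ 'n::_. z $ i = 0})"
    proof (cases "to_gaps x \<in> orthant")
      case True
      then show ?thesis using x eq by blast
    next
      case False
      then obtain i where "to_gaps x $ i = 0"
        using absorbing_gaps[of x] x by (auto simp: orthant_def not_less intro: antisym)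
      then show ?thesis using eq by blast
    qed
  qed
  ultimately show ?thesis by (rule negligible_subset)
qed

end

theorem corollary2:
  assumes "CARD('n::{finite,wellorder}) \<ge> 2"
  shows "ergodic_on lebesgue
    (Sigma_cone :: (real ^ 'n::{finite,wellorder}) set) selmer"
  unfolding ergodic_on_def
proof (intro allI impI)
  fix V :: "(real ^ 'n::_) set"
  assume "V \<in> sets lebesgue \<and> V \<subseteq> Sigma_cone \<and> selmer ` V \<subseteq> V \<and> Sigma_cone \<inter> selmer -` V \<subseteq> V"
  then have V: "V \<in> sets lebesgue" "V \<subseteq> Sigma_cone" "selmer ` V \<subseteq> V" "Sigma_cone \<inter> selmer -` V \<subseteq> V"
    by auto
  note two = assms
  have inj: "to_gaps x = to_gaps y \<longleftrightarrow> x = y" for x y :: "real ^ 'n::_"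
    by (metis of_gaps_to_gaps[OF two])
  interpret step_invariant "orthant \<inter> to_gaps ` V"
  proof unfold_locales
    show "orthant \<inter> to_gaps ` V \<in> sets lebesgue"
      using orthant_lebesgue V(1) by (intro sets.Int lebesgue_sets_linear_image linear_to_gaps)
    fix b and z :: "real ^ 'n::_" assume z: "z \<in> orthant"
    define y where "y = of_gaps z"
    have zy: "z = to_gaps y" by (simp add: y_def to_gaps_of_gaps[OF two])
    have sz: "step b z \<in> orthant" "step b z = to_gaps (branch b y)"
      using z step_orthant[OF two] by (auto simp: zy to_gaps_branch[OF two])
    have cone: "y \<in> Sigma_cone" "branch b y \<in> Sigma_cone"
      using z sz by (auto intro!: gaps_nonneg_Sigma[OF two] simp: zy orthant_def less_imp_le)
    then have "selmer (branch b y) = y"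
      by (intro selmer_branch[OF two]) (simp add: Sigma_cone_def)
    \<comment> \<open>Forward invariance of \<open>V\<close> gives one direction; the preimage
      condition, applicable because \<open>branch b y\<close> lies in the cone, gives the
      other.\<close>
    then have "branch b y \<in> V \<longleftrightarrow> y \<in> V"
      using V cone by auto
    then show "step b z \<in> orthant \<inter> to_gaps ` V \<longleftrightarrow> z \<in> orthant \<inter> to_gaps ` V"
      using z sz by (auto simp: zy inj)
  qed (simp_all only: two Int_lower1)
  from negligible_or_conegligible show "V \<in> null_sets lebesgue \<or> Sigma_cone - V \<in> null_sets lebesgue"
    unfolding negligible_iff_null_sets[symmetric]
  proof (elim disj_forward)
    assume "negligible (orthant \<inter> to_gaps ` V)"
    then show "negligible V"
      by (rule negligible_from_absorbing[OF two V(2,3) negligible_absorbing_of_gaps[OF two]])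
  next
    assume "negligible (orthant - orthant \<inter> to_gaps ` V)"
    moreover have "orthant \<inter> to_gaps ` (Sigma_cone - V) \<subseteq> orthant - orthant \<inter> to_gaps ` V"
      by (auto simp: inj)
    ultimately have neg: "negligible (orthant \<inter> to_gaps ` (Sigma_cone - V))"
      by (rule negligible_subset)
    \<comment> \<open>The preimage condition on \<open>V\<close> is forward invariance of its
      complement, so the same reduction applies to the latter.\<close>
    have "selmer ` (Sigma_cone - V) \<subseteq> Sigma_cone - V"
      using V(4) selmer_in_Sigma_cone by auto
    then show "negligible (Sigma_cone - V)"
      by (rule negligible_from_absorbing[OF two Diff_subset _ negligible_absorbing_of_gaps[OF two neg]])
  qed
qed

end
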